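(* Let $q\ge3$ be a prime power, $r=\lfloor(q-1)/2\rfloor$, $\gamma=\frac{q}{3r}\left(\frac12-\frac rq\right)^2$, $n\ge1$, $w:\mathbb{F}_q^n\to[0,\infty)$, and $S_w=\sum_{\sigma\in\mathbb{F}_q^n}w(\sigma)$. For any $\delta>0$, the Unconstrained MB-WISH algorithm run with parameters $q,r,\delta$ makes $\Theta(n\log\frac n\delta)$ calls to the MAX-oracle and, with probability at least $1-\delta$, outputs $\hat Z$ which is a $(q/r)^2$-approximation of $S_w$, i.e. $S_w/(q/r)^2\le\hat Z\le(q/r)^2S_w$.
   Context: Fix an enumeration $\mathbb{F}_q=\{\alpha_0,\dots,\alpha_{q-1}\}$ with $\alpha_a<\alpha_b$ iff $a<b$, and order $\mathbb{F}_q^n$ lexicographically with respect to this ordering. The MAX-oracle computes exactly a maximum of $w(\cdot)$ over an explicitly specified finite set of arguments of the form below (an unconstrained optimization). Unconstrained MB-WISH: set $\ell=\lceil\frac1\gamma\ln\frac{2n}\delta\rceil$, $n'=\lceil n\log_{q/r}q\rceil$, $M_0=\max_{\sigma\in\mathbb{F}_q^n}w(\sigma)$. For $i=1,\dots,n$ and $k=1,\dots,\ell$ (independently): sample a uniformly random ordered basis $(e_1,\dots,e_n)$ of $\mathbb{F}_q^n$, let $A$ be the $n\times(n-i)$ matrix with columns $e_1,\dots,e_{n-i}$ and $R$ the $n\times i$ matrix with columns $e_{n-i+1},\dots,e_n$, sample $b\in\mathbb{F}_q^n$ uniformly, and set $w_i^{(k)}=\max\{w(Ax+Ry+b): x\in\mathbb{F}_q^{n-i},\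 y\in\{\alpha_0,\dots,\alpha_{r-1}\}^i\}$. For $i=n+1,\dots,n'$ and $k=1,\dots,\ell$ (independently): let $s_i$ be the $\lceil r^i/q^{i-n}\rceil$-th element of $\mathbb{F}_q^n$ in lexicographic order, $\mathcal S_i=\{x\in\mathbb{F}_q^n: x\text{ lexicographically precedes } s_i\}$; sample a uniformly random invertible $A\in\mathbb{F}_q^{n\times n}$ and uniform $b\in\mathbb{F}_q^n$, and set $w_i^{(k)}=\max_{y\in\mathcal S_i}w(Ay+b)$ (max over empty set is $0$). In both cases let $M_i$ be the median of $w_i^{(1)},\dots,w_i^{(\ell)}$. Output $\hat Z=M_0+\left(\frac qr-1\right)\sum_{i=0}^{n'-1}M_{i+1}\left(\frac qr\right)^i$. All arithmetic is over $\mathbb{F}_q$. *)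

theory Defs
  imports
    "HOL-Probability.Probability_Mass_Function"
    "HOL-Library.Landau_Symbols"
    "Jordan_Normal_Form.VS_Connect"
begin

text \<open>
  The field of order \<open>q\<close> is a type \<open>'a\<close> of class \<open>{field, finite}\<close>, and \<open>\<alpha>\<close> enumerates it:
  \<open>\<alpha>\<close> is a bijection from \<open>{..<CARD('a)}\<close> onto \<open>UNIV\<close>, and \<open>\<alpha> a\<close> is smaller than \<open>\<alpha> b\<close> iff \<open>a < b\<close>.
\<close>

definition field_order :: "(nat \<Rightarrow> 'a::{field,finite}) \<Rightarrow> 'a rel" where
  "field_order \<alpha> = {(\<alpha> a, \<alpha> b) | a b. a < b \<and> b < CARD('a)}"

definition lex_precedes ::
    "(nat \<Rightarrow> 'a::{field,finite}) \<Rightarrow> 'a Matrix.vec \<Rightarrow> 'a Matrix.vec \<Rightarrow> bool" where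
  "lex_precedes \<alpha> x y \<longleftrightarrow> (list_of_vec x, list_of_vec y) \<in> lex (field_order \<alpha>)"

text \<open>Positions are counted from 1, so \<open>m = 1\<close> gives the least vector.\<close>

definition lex_nth :: "(nat \<Rightarrow> 'a::{field,finite}) \<Rightarrow> nat \<Rightarrow> nat \<Rightarrow> 'a Matrix.vec" where
  "lex_nth \<alpha> n m = (THE s. s \<in> carrier_vec n \<and>
     card {x \<in> carrier_vec n. x = s \<or> lex_precedes \<alpha> x s} = m)"

definition lex_prefix :: "(nat \<Rightarrow> 'a::{field,finite}) \<Rightarrow> nat \<Rightarrow> nat \<Rightarrow> nat \<Rightarrow> 'a Matrix.vec set" where
  "lex_prefix \<alpha> r n i =
     (let s = lex_nth \<alpha> n (nat \<lceil>real r ^ i / real CARD('a) ^ (i - n)\<rceil>)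
      in {x \<in> carrier_vec n. lex_precedes \<alpha> x s})"

definition ordered_bases :: "nat \<Rightarrow> 'a::field Matrix.vec list set" where
  "ordered_bases n =
     {es. distinct es \<and> vectorspace.basis class_ring (module_vec TYPE('a) n) (set es)}"

text \<open>For even length the median is the mean of the two middle entries; the value for the empty
  list is irrelevant.\<close>

definition median :: "real list \<Rightarrow> real" where
  "median xs = (let ys = sort xs; m = length xs div 2 in
     if odd (length xs) then ys ! m else (ys ! (m - 1) + ys ! m) / 2)"

text \<open>
  A randomized program with access to the MAX-oracle is a distribution over pairs consisting of
  a result and the number of oracle calls made to obtain it.
\<close>

type_synonym 'b oracle_prog = "('b \<times> nat) pmf"

definition max_oracle :: "('b \<Rightarrow> real) \<Rightarrow> 'b set \<Rightarrow> real oracle_prog" where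
  "max_oracle w X = return_pmf (if X = {} then 0 else Max (w ` X), 1)"

text \<open>Independent execution of a list of programs, collecting the results and adding up the calls.\<close>

primrec run_all :: "'b oracle_prog list \<Rightarrow> 'b list oracle_prog" where
  "run_all [] = return_pmf ([], 0)"
| "run_all (p # ps) = do {
     (x, c) \<leftarrow> p;
     (xs, d) \<leftarrow> run_all ps;
     return_pmf (x # xs, c + d)
   }"

text \<open>One sample \<open>w\<^sub>i\<^sup>(\<^sup>k\<^sup>)\<close>.\<close>

definition mb_wish_sample ::
    "(nat \<Rightarrow> 'a::{field,finite}) \<Rightarrow> nat \<Rightarrow> nat \<Rightarrow> ('a Matrix.vec \<Rightarrow> real) \<Rightarrow> nat \<Rightarrow> real oracle_prog" where
  "mb_wish_sample \<alpha> r n w i =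
    (if i \<le> n then do {
       es \<leftarrow> pmf_of_set (ordered_bases n);
       b \<leftarrow> pmf_of_set (carrier_vec n);
       let A = mat_of_cols n (take (n - i) es);
       let R = mat_of_cols n (drop (n - i) es);
       max_oracle w {A *\<^sub>v x + R *\<^sub>v y + b | x y.
         x \<in> carrier_vec (n - i) \<and> y \<in> carrier_vec i \<and> set\<^sub>v y \<subseteq> \<alpha> ` {..<r}}
     } else do {
       A \<leftarrow> pmf_of_set {A \<in> carrier_mat n n. invertible_mat A};
       b \<leftarrow> pmf_of_set (carrier_vec n);
       max_oracle w {A *\<^sub>v y + b | y. y \<in> lex_prefix \<alpha> r n i}
     })"

definition mb_wish_level ::
    "(nat \<Rightarrow> 'a::{field,finite}) \<Rightarrow> nat \<Rightarrow> nat \<Rightarrow> ('a Matrix.vec \<Rightarrow> real) \<Rightarrow> nat \<Rightarrow> nat \<Rightarrow> real oracle_prog" where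
  "mb_wish_level \<alpha> r n w l i = do {
     (ws, c) \<leftarrow> run_all (replicate l (mb_wish_sample \<alpha> r n w i));
     return_pmf (median ws, c)
   }"

text \<open>In the list \<open>Ms\<close> the entry \<open>Ms ! i\<close> is \<open>M\<^sub>i\<^sub>+\<^sub>1\<close>.\<close>

definition unconstrained_mb_wish ::
    "(nat \<Rightarrow> 'a::{field,finite}) \<Rightarrow> nat \<Rightarrow> real \<Rightarrow> real \<Rightarrow> nat \<Rightarrow> ('a Matrix.vec \<Rightarrow> real) \<Rightarrow> real oracle_prog" where
  "unconstrained_mb_wish \<alpha> r \<gamma> \<delta> n w = do {
     let q = real CARD('a);
     let l = nat \<lceil>1 / \<gamma> * ln (2 * real n / \<delta>)\<rceil>;
     let n' = nat \<lceil>real n * log (q / real r) q\<rceil>;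
     (M0, c) \<leftarrow> max_oracle w (carrier_vec n);
     (Ms, d) \<leftarrow> run_all (map (mb_wish_level \<alpha> r n w l) [1..<Suc n']);
     return_pmf (M0 + (q / real r - 1) * (\<Sum>i<n'. Ms ! i * (q / real r) ^ i), c + d)
   }"

text \<open>
  The regime for the two-parameter asymptotics: \<open>n \<ge> 1\<close> and \<open>\<delta> > 0\<close> with \<open>n / \<delta>\<close> tending to infinity.
  A property holds eventually iff there is a \<open>K\<close> such that it holds for all these \<open>(n, \<delta>)\<close> with
  \<open>n / \<delta> \<ge> K\<close>; this covers \<open>n\<close> tending to infinity for fixed \<open>\<delta>\<close> and \<open>\<delta>\<close> tending to 0 for fixed \<open>n\<close>.
\<close>

definition ratio_at_top :: "(nat \<times> real) filter" where
  "ratio_at_top = inf (filtercomap (\<lambda>(n, \<delta>). real n / \<delta>) at_top)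
     (principal {(n, \<delta>). 1 \<le> n \<and> 0 < \<delta>})"

lemma eventually_ratio_at_top:
  "eventually P ratio_at_top \<longleftrightarrow>
     (\<exists>K. \<forall>n \<delta>. 1 \<le> n \<longrightarrow> 0 < \<delta> \<longrightarrow> K \<le> real n / \<delta> \<longrightarrow> P (n, \<delta>))"
  unfolding ratio_at_top_def eventually_inf_principal eventually_filtercomap_at_top_linorder
  by auto

lemma ratio_at_top_neq_bot: "ratio_at_top \<noteq> bot"
proof -
  have "\<exists>n \<delta>. 1 \<le> n \<and> 0 < \<delta> \<and> K \<le> real n / \<delta>" for K :: real
  proof -
    obtain m :: nat where "K \<le> real m" using real_arch_simple by blast
    then have "K \<le> real (Suc m) / 1" by simp
    then show ?thesis by (intro exI[of _ "Suc m"] exI[of _ "1::real"]) simp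
  qed
  then show ?thesis
    unfolding trivial_limit_def eventually_ratio_at_top by blast
qed

end

theory Submission
  imports Defs "Jordan_Normal_Form.DL_Rank"
begin

text \<open>
  Put \<open>\<kappa> = q / r\<close> and let \<open>a\<^sub>1 \<ge> a\<^sub>2 \<ge> \<dots>\<close> be the values of \<open>w\<close> in decreasing order. In both ranges of \<open>i\<close> the
  sample \<open>w\<^sub>i\<close> is the maximum of \<open>w\<close> over the image of a fixed set of size about \<open>q\<^sup>n / \<kappa>\<^sup>i\<close> under a
  uniformly random affine bijection. The affine group is 2-transitive, so this image is pairwise
  independent: it misses the \<open>\<kappa>\<^sup>i\<^sup>+\<^sup>1\<close> largest values with probability at most \<open>1 / (1 + \<kappa>)\<close> (second moment),
  and hits the \<open>\<kappa>\<^sup>i\<^sup>-\<^sup>2\<close> largest values with probability at most \<open>1 / \<kappa>\<^sup>2 \<le> 1 / (1 + \<kappa>)\<close> (union bound).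
  By Chernoff's bound the median \<open>M\<^sub>i\<close> lies between these two quantiles up to an error probability
  \<open>2 (2 \<surd>\<kappa> / (1 + \<kappa>))\<^sup>l\<close>, and comparing the sum of \<open>w\<close> with its geometric blocks shows that such
  medians give a \<open>\<kappa>\<^sup>2\<close>-approximation.

  Allowing the upper quantile to be off by two levels instead of one costs nothing in the
  approximation factor, but it is what makes the union bound work: the number of levels can exceed
  \<open>2 n\<close>, and then error probabilities of order \<open>exp (- \<gamma> l) \<le> \<delta> / (2 n)\<close> would not suffice.
\<close>

text \<open>The constant \<gamma> is what the multiplicative Chernoff bound exp (- \<eta>^2 \<mu> /
  3) gives for a per-sample error of r / q: with \<mu> = l r / q and (1 + \<eta>) r / q = 1 / 2 one
  gets \<eta>^2 \<mu> / 3 = \<gamma> l. As q grows, r / q approaches 1 / 2 and \<gamma> tends to 0.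
  The error 1 / (1 + \<kappa>) used here stays below 1 / 3, so its exponent stays bounded away from
  0. The ratio of the two exponents, called \<open>gain\<close>, grows like r^2, while the number of
  levels per coordinate grows only like log r; this gap pays for the union bound over all
  levels.\<close>

unbundle no vec_syntax

section \<open>Random maps that are uniform on pairs of points\<close>

lemma card_collect_sum:
  assumes "finite A"
  shows "card {x\<in>A. P x} = (\<Sum>x\<in>A. if P x then 1 else 0)"
  using assms by (simp add: sum.If_cases Int_def)

text \<open>Only the first two moments of the number of hits enter the argument, and these
  conditions determine them. Probabilities are counts over \<Omega>, multiplied out so that the
  conditions are equations between natural numbers.\<close>

locale pairwise_uniform =
  fixes \<Omega> :: "'o set" and V :: "'v set" and f :: "'o \<Rightarrow> 'v \<Rightarrow> 'v"
  assumes finite_space: "finite \<Omega>" and space_nonempty: "\<Omega> \<noteq> {}" and finite_points: "finite V"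
    and points_two: "2 \<le> card V"
    and maps: "\<omega> \<in> \<Omega> \<Longrightarrow> y \<in> V \<Longrightarrow> f \<omega> y \<in> V"
    and inj: "\<omega> \<in> \<Omega> \<Longrightarrow> inj_on (f \<omega>) V"
    and uniform: "y \<in> V \<Longrightarrow> u \<in> V \<Longrightarrow> card {\<omega>\<in>\<Omega>. f \<omega> y = u} * card V = card \<Omega>"
    and uniform_pair: "y \<in> V \<Longrightarrow> y' \<in> V \<Longrightarrow> y \<noteq> y' \<Longrightarrow> u \<in> V \<Longrightarrow> u' \<in> V \<Longrightarrow> u \<noteq> u' \<Longrightarrow>
      card {\<omega>\<in>\<Omega>. f \<omega> y = u \<and> f \<omega> y' = u'} * (card V * (card V - 1)) = card \<Omega>"
begin

definition hits :: "'v set \<Rightarrow> 'v set \<Rightarrow> 'o \<Rightarrow> nat" where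
  "hits D G \<omega> = card {y\<in>D. f \<omega> y \<in> G}"

lemma hits_pos_iff:
  assumes "D \<subseteq> V"
  shows "0 < hits D G \<omega> \<longleftrightarrow> f \<omega> ` D \<inter> G \<noteq> {}"
  using finite_subset[OF assms finite_points] by (auto simp: hits_def card_gt_0_iff)

lemma card_hit_point:
  assumes "y \<in> V" "G \<subseteq> V"
  shows "real (card {\<omega>\<in>\<Omega>. f \<omega> y \<in> G}) = real (card G) * real (card \<Omega>) / real (card V)"
proof -
  have fG: "finite G" using assms finite_points finite_subset by blast
  have "{\<omega>\<in>\<Omega>. f \<omega> y \<in> G} = (\<Union>u\<in>G. {\<omega>\<in>\<Omega>. f \<omega> y = u})" by auto
  then have "card {\<omega>\<in>\<Omega>. f \<omega> y \<in> G} = (\<Sum>u\<in>G. card {\<omega>\<in>\<Omega>. f \<omega> y = u})"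
    using fG finite_space by (simp, subst card_UN_disjoint) auto
  also have "real \<dots> = (\<Sum>u\<in>G. real (card \<Omega>) / real (card V))"
  proof (simp only: of_nat_sum, rule sum.cong[OF refl])
    fix u assume "u \<in> G"
    then have "card {\<omega>\<in>\<Omega>. f \<omega> y = u} * card V = card \<Omega>" using uniform assms by auto
    then have "real (card {\<omega>\<in>\<Omega>. f \<omega> y = u}) * real (card V) = real (card \<Omega>)"
      by (metis of_nat_mult)
    then show "real (card {\<omega>\<in>\<Omega>. f \<omega> y = u}) = real (card \<Omega>) / real (card V)"
      using points_two by (simp add: field_simps)
  qed
  finally show ?thesis by simp
qed

text \<open>By injectivity the two images differ, so only the |G| (|G| - 1) ordered pairs of
  distinct targets contribute, each with the same count.\<close>

lemma card_hit_pair: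
  assumes "y \<in> V" "y' \<in> V" "y \<noteq> y'" "G \<subseteq> V"
  shows "real (card {\<omega>\<in>\<Omega>. f \<omega> y \<in> G \<and> f \<omega> y' \<in> G}) =
    real (card G) * (real (card G) - 1) * real (card \<Omega>) / (real (card V) * (real (card V) - 1))"
proof -
  define P where "P = Sigma G (\<lambda>u. G - {u})"
  have fG: "finite G" using assms finite_points finite_subset by blast
  have fP: "finite P" using fG by (auto simp: P_def)
  have "f \<omega> y \<noteq> f \<omega> y'" if "\<omega> \<in> \<Omega>" for \<omega> using inj[OF that] assms by (auto dest: inj_onD)
  then have "{\<omega>\<in>\<Omega>. f \<omega> y \<in> G \<and> f \<omega> y' \<in> G} = (\<Union>p\<in>P. {\<omega>\<in>\<Omega>. f \<omega> y = fst p \<and> f \<omega> y' = snd p})"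
    by (force simp: P_def)
  then have "card {\<omega>\<in>\<Omega>. f \<omega> y \<in> G \<and> f \<omega> y' \<in> G} = (\<Sum>p\<in>P. card {\<omega>\<in>\<Omega>. f \<omega> y = fst p \<and> f \<omega> y' = snd p})"
    using fP finite_space by (simp, subst card_UN_disjoint) auto
  also have "real \<dots> = (\<Sum>p\<in>P. real (card \<Omega>) / (real (card V) * (real (card V) - 1)))"
  proof (simp only: of_nat_sum, rule sum.cong[OF refl])
    fix p assume "p \<in> P"
    then have "card {\<omega>\<in>\<Omega>. f \<omega> y = fst p \<and> f \<omega> y' = snd p} * (card V * (card V - 1)) = card \<Omega>"
      using assms by (intro uniform_pair) (auto simp: P_def)
    then have "real (card {\<omega>\<in>\<Omega>. f \<omega> y = fst p \<and> f \<omega> y' = snd p}) * (real (card V) * (real (card V) - 1)) = real (card \<Omega>)"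
      using points_two by (metis (no_types, lifting) of_nat_1 of_nat_diff of_nat_mult one_le_numeral order_trans)
    then show "real (card {\<omega>\<in>\<Omega>. f \<omega> y = fst p \<and> f \<omega> y' = snd p}) = real (card \<Omega>) / (real (card V) * (real (card V) - 1))"
      using points_two by (simp add: field_simps)
  qed
  also have "real (card P) = real (card G) * (real (card G) - 1)"
  proof -
    have "card P = card G * (card G - 1)" unfolding P_def using fG by (subst card_SigmaI) auto
    then show ?thesis by (cases "card G") (auto simp: algebra_simps)
  qed
  then have "(\<Sum>p\<in>P. real (card \<Omega>) / (real (card V) * (real (card V) - 1))) =
    real (card G) * (real (card G) - 1) * real (card \<Omega>) / (real (card V) * (real (card V) - 1))" by simp
  finally show ?thesis .
qed

lemma sum_hits:
  assumes "D \<subseteq> V" "G \<subseteq> V"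
  shows "(\<Sum>\<omega>\<in>\<Omega>. real (hits D G \<omega>)) = real (card D) * real (card G) * real (card \<Omega>) / real (card V)"
proof -
  have fD: "finite D" using assms finite_points finite_subset by blast
  have "(\<Sum>\<omega>\<in>\<Omega>. hits D G \<omega>) = (\<Sum>\<omega>\<in>\<Omega>. \<Sum>y\<in>D. if f \<omega> y \<in> G then 1 else 0)"
    by (simp only: hits_def card_collect_sum[OF fD])
  also have "\<dots> = (\<Sum>y\<in>D. card {\<omega>\<in>\<Omega>. f \<omega> y \<in> G})"
    unfolding card_collect_sum[OF finite_space] by (rule sum.swap)
  finally have "real (\<Sum>\<omega>\<in>\<Omega>. hits D G \<omega>) = real (\<Sum>y\<in>D. card {\<omega>\<in>\<Omega>. f \<omega> y \<in> G})"
    by (rule arg_cong)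
  then have "(\<Sum>\<omega>\<in>\<Omega>. real (hits D G \<omega>)) = (\<Sum>y\<in>D. real (card {\<omega>\<in>\<Omega>. f \<omega> y \<in> G}))"
    by (simp only: of_nat_sum)
  also have "\<dots> = (\<Sum>y\<in>D. real (card G) * real (card \<Omega>) / real (card V))"
    using assms by (intro sum.cong refl card_hit_point) auto
  finally show ?thesis by simp
qed

text \<open>The square of a count is the count itself (the diagonal) plus the number of ordered
  pairs of distinct points that both hit. The first moment is factored out because it cancels
  against Cauchy--Schwarz later.\<close>

lemma sum_hits_squared:
  assumes "D \<subseteq> V" "G \<subseteq> V"
  shows "(\<Sum>\<omega>\<in>\<Omega>. (real (hits D G \<omega>))\<^sup>2) =
    real (card D) * real (card G) * real (card \<Omega>) / real (card V) *
      (1 + (real (card D) - 1) * (real (card G) - 1) / (real (card V) - 1))"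
proof -
  have fD: "finite D" using assms finite_points finite_subset by blast
  define P where "P = Sigma D (\<lambda>u. D - {u})"
  have cP: "real (card P) = real (card D) * (real (card D) - 1)"
  proof -
    have "card P = card D * (card D - 1)" unfolding P_def using fD by (subst card_SigmaI) auto
    then show ?thesis by (cases "card D") (auto simp: algebra_simps)
  qed
  have fP: "finite P" using fD by (auto simp: P_def)
  have *: "(hits D G \<omega>)\<^sup>2 = hits D G \<omega> + (\<Sum>p\<in>P. if f \<omega> (fst p) \<in> G \<and> f \<omega> (snd p) \<in> G then 1 else 0)" for \<omega>
  proof -
    let ?Y = "{y\<in>D. f \<omega> y \<in> G}"
    have "(\<Sum>p\<in>P. if f \<omega> (fst p) \<in> G \<and> f \<omega> (snd p) \<in> G then 1 else 0) = card {p\<in>P. f \<omega> (fst p) \<in> G \<and> f \<omega> (snd p) \<in> G}"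
      by (simp only: card_collect_sum[OF fP])
    also have "{p\<in>P. f \<omega> (fst p) \<in> G \<and> f \<omega> (snd p) \<in> G} = Sigma ?Y (\<lambda>u. ?Y - {u})"
      by (auto simp: P_def)
    also have "card \<dots> = card ?Y * (card ?Y - 1)" using fD by (subst card_SigmaI) auto
    finally show ?thesis unfolding hits_def by (cases "card ?Y") (auto simp: power2_eq_square)
  qed
  have "(\<Sum>\<omega>\<in>\<Omega>. (hits D G \<omega>)\<^sup>2) = (\<Sum>\<omega>\<in>\<Omega>. hits D G \<omega>) + (\<Sum>p\<in>P. card {\<omega>\<in>\<Omega>. f \<omega> (fst p) \<in> G \<and> f \<omega> (snd p) \<in> G})"
  proof -
    have "(\<Sum>\<omega>\<in>\<Omega>. \<Sum>p\<in>P. if f \<omega> (fst p) \<in> G \<and> f \<omega> (snd p) \<in> G then 1 else 0) =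
        (\<Sum>p\<in>P. card {\<omega>\<in>\<Omega>. f \<omega> (fst p) \<in> G \<and> f \<omega> (snd p) \<in> G})"
      unfolding card_collect_sum[OF finite_space] by (rule sum.swap)
    then show ?thesis by (simp only: * sum.distrib)
  qed
  then have "real (\<Sum>\<omega>\<in>\<Omega>. (hits D G \<omega>)\<^sup>2) = 
      real ((\<Sum>\<omega>\<in>\<Omega>. hits D G \<omega>) + (\<Sum>p\<in>P. card {\<omega>\<in>\<Omega>. f \<omega> (fst p) \<in> G \<and> f \<omega> (snd p) \<in> G}))" by presburger
  then have "(\<Sum>\<omega>\<in>\<Omega>. (real (hits D G \<omega>))\<^sup>2) =
      (\<Sum>\<omega>\<in>\<Omega>. real (hits D G \<omega>)) + (\<Sum>p\<in>P. real (card {\<omega>\<in>\<Omega>. f \<omega> (fst p) \<in> G \<and> f \<omega> (snd p) \<in> G}))"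
    by simp
  also have "(\<Sum>p\<in>P. real (card {\<omega>\<in>\<Omega>. f \<omega> (fst p) \<in> G \<and> f \<omega> (snd p) \<in> G})) =
     (\<Sum>p\<in>P. real (card G) * (real (card G) - 1) * real (card \<Omega>) / (real (card V) * (real (card V) - 1)))"
    using assms by (intro sum.cong refl card_hit_pair) (auto simp: P_def)
  also have "\<dots> = real (card D) * (real (card D) - 1) * (real (card G) * (real (card G) - 1) * real (card \<Omega>) / (real (card V) * (real (card V) - 1)))"
    by (simp add: cP)
  finally have eq: "(\<Sum>\<omega>\<in>\<Omega>. (real (hits D G \<omega>))\<^sup>2) = real (card D) * real (card G) * real (card \<Omega>) / real (card V) +
      real (card D) * (real (card D) - 1) * (real (card G) * (real (card G) - 1) * real (card \<Omega>) / (real (card V) * (real (card V) - 1)))"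
    by (simp only: sum_hits[OF assms])
  show ?thesis unfolding eq by (simp add: distrib_left mult_ac)
qed

text \<open>Markov's inequality: the indicator of a hit is at most the number of hits.\<close>

lemma card_hit_le:
  assumes "D \<subseteq> V" "G \<subseteq> V"
  shows "real (card {\<omega>\<in>\<Omega>. f \<omega> ` D \<inter> G \<noteq> {}}) \<le> real (card D) * real (card G) * real (card \<Omega>) / real (card V)"
proof -
  have "card {\<omega>\<in>\<Omega>. f \<omega> ` D \<inter> G \<noteq> {}} = (\<Sum>\<omega>\<in>\<Omega>. if f \<omega> ` D \<inter> G \<noteq> {} then 1 else 0)"
    by (rule card_collect_sum[OF finite_space])
  also have "\<dots> \<le> (\<Sum>\<omega>\<in>\<Omega>. hits D G \<omega>)"
    using hits_pos_iff[OF assms(1)] by (intro sum_mono) (simp add: Suc_le_eq)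
  finally have "real (card {\<omega>\<in>\<Omega>. f \<omega> ` D \<inter> G \<noteq> {}}) \<le> real (\<Sum>\<omega>\<in>\<Omega>. hits D G \<omega>)"
    by (simp only: of_nat_le_iff)
  then show ?thesis by (simp add: sum_hits[OF assms])
qed

text \<open>Second moment method: Cauchy--Schwarz bounds the number of \<open>\<omega>\<close> with a hit from below by
  \<open>(\<Sum>\<omega>. hits)\<^sup>2 / (\<Sum>\<omega>. hits\<^sup>2)\<close>. The slack \<open>+ 1\<close> in the size of \<open>D\<close> absorbs the rounding in the
  lexicographic prefixes.\<close>

lemma card_miss_le:
  assumes D: "D \<subseteq> V" and G: "G \<subseteq> V" and \<kappa>: "2 \<le> \<kappa>"
    and large: "\<kappa> * real (card V) \<le> (real (card D) + 1) * real (card G)"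
  shows "real (card {\<omega>\<in>\<Omega>. f \<omega> ` D \<inter> G = {}}) \<le> real (card \<Omega>) / (1 + \<kappa>)"
proof -
  define m g N where "m = real (card D)" "g = real (card G)" "N = real (card V)"
  define h where "h = card {\<omega>\<in>\<Omega>. f \<omega> ` D \<inter> G \<noteq> {}}"
  have N: "2 \<le> N" using points_two by (simp add: m_g_N_def)
  have gN: "g \<le> N" using card_mono[OF finite_points G] by (simp add: m_g_N_def)
  have g0: "g > 0"
  proof (rule ccontr)
    assume "\<not> g > 0"
    then have "\<kappa> * N \<le> 0" using large by (simp add: m_g_N_def)
    moreover have "\<kappa> * N > 0" using \<kappa> N by simp
    ultimately show False by simp
  qed
  \<comment> \<open>The slack cannot hide an empty \<open>D\<close>: since g \<le> N, the assumption
    forces m + 1 \<ge> \<kappa> \<ge> 2.\<close>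
  have m1: "m \<ge> 1"
  proof -
    have "2 * N \<le> \<kappa> * N" using \<kappa> N by simp
    also have "\<dots> \<le> (m + 1) * N" using large gN by (smt (verit) m_g_N_def mult_left_mono of_nat_0_le_iff)
    finally have "2 \<le> m + 1" using N by simp
    then show ?thesis by simp
  qed
  have O: "real (card \<Omega>) > 0" using finite_space space_nonempty by (simp add: card_gt_0_iff)
  define W where "W = real (card \<Omega>)"
  have ch: "real h * (\<Sum>\<omega>\<in>\<Omega>. (real (hits D G \<omega>))\<^sup>2) \<ge> (\<Sum>\<omega>\<in>\<Omega>. real (hits D G \<omega>))\<^sup>2"
  proof -
    let ?H = "{\<omega>\<in>\<Omega>. f \<omega> ` D \<inter> G \<noteq> {}}"
    have z: "hits D G \<omega> = 0" if "\<omega> \<in> \<Omega> - ?H" for \<omega> using that hits_pos_iff[OF D, of G \<omega>] by auto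
    have "(\<Sum>\<omega>\<in>\<Omega>. real (hits D G \<omega>)) = (\<Sum>\<omega>\<in>?H. real (hits D G \<omega>))"
      using z finite_space by (intro sum.mono_neutral_right) auto
    moreover have "(\<Sum>\<omega>\<in>\<Omega>. (real (hits D G \<omega>))\<^sup>2) = (\<Sum>\<omega>\<in>?H. (real (hits D G \<omega>))\<^sup>2)"
      using z finite_space by (intro sum.mono_neutral_right) auto
    moreover have "(\<Sum>\<omega>\<in>?H. real (hits D G \<omega>) * 1)\<^sup>2 \<le> (\<Sum>\<omega>\<in>?H. (real (hits D G \<omega>))\<^sup>2) * (\<Sum>\<omega>\<in>?H. 1\<^sup>2)"
      by (rule Cauchy_Schwarz_ineq_sum)
    ultimately show ?thesis unfolding h_def by (simp add: mult.commute)
  qed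
  \<comment> \<open>\<open>B\<close> is the second moment of the hits divided by the first, so a hit
    has probability at least m g / (N B). The next fact says that this is at least \<kappa> / (1 +
    \<kappa>).\<close>
  define B where "B = 1 + (m - 1) * (g - 1) / (N - 1)"
  have B0: "B * N * \<kappa> \<le> m * g * (1 + \<kappa>)"
  proof -
    \<comment> \<open>Hits at distinct points are negatively correlated: the second point hits with
      probability at most g / N given that the first does.\<close>
    have "(g - 1) / (N - 1) \<le> g / N" using gN N by (simp add: field_simps)
    then have "(m - 1) * ((g - 1) / (N - 1)) \<le> (m - 1) * (g / N)" using m1 by (intro mult_left_mono) auto
    then have "B \<le> 1 + (m - 1) * g / N" by (simp add: B_def)
    then have "B * (N * \<kappa>) \<le> (1 + (m - 1) * g / N) * (N * \<kappa>)" using N \<kappa> by (intro mult_right_mono) auto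
    also have "\<dots> = N * \<kappa> + (m - 1) * g * \<kappa>" using N by (simp add: field_simps)
    \<comment> \<open>The slack contributes one surplus g. It is absorbed by the g \<kappa> that the
      factor m - 1, instead of m, saves in the pair term.\<close>
    also have "\<dots> \<le> (m + 1) * g + (m - 1) * g * \<kappa>" using large by (simp add: m_g_N_def mult.commute)
    also have "\<dots> \<le> m * g * (1 + \<kappa>)"
    proof -
      have "g * 1 \<le> g * \<kappa>" using \<kappa> g0 by (intro mult_left_mono) auto
      then show ?thesis by (simp add: algebra_simps)
    qed
    finally show ?thesis by (simp add: mult.assoc)
  qed
  have Bpos: "B > 0" 
  proof -
    have "g \<ge> 1" using g0 by (cases "card G") (auto simp: m_g_N_def)
    then have "(m - 1) * (g - 1) / (N - 1) \<ge> 0" using m1 N by (intro divide_nonneg_nonneg mult_nonneg_nonneg) auto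
    then show ?thesis by (simp add: B_def)
  qed
  have hlow: "real h * (1 + \<kappa>) \<ge> W * \<kappa>"
  proof -
    define c where "c = m * g * W / N"
    have c0: "c > 0" using m1 g0 O N by (simp add: c_def W_def)
    have "c\<^sup>2 \<le> real h * (c * B)" using ch unfolding sum_hits[OF D G] sum_hits_squared[OF D G] c_def B_def W_def m_g_N_def by simp
    then have "c \<le> real h * B" using c0 by (simp add: power2_eq_square)
    then have "m * g * W \<le> real h * B * N" using N by (simp add: c_def field_simps)
    then have "m * g * W * \<kappa> \<le> real h * (B * N * \<kappa>)" using \<kappa> by (simp add: mult.assoc[symmetric] mult_right_mono)
    also have "\<dots> \<le> real h * (m * g * (1 + \<kappa>))" using B0 by (intro mult_left_mono) auto
    finally have "(m * g) * (W * \<kappa>) \<le> (m * g) * (real h * (1 + \<kappa>))" by (simp add: mult_ac)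
    then show ?thesis using m1 g0 by simp
  qed
  have "card {\<omega>\<in>\<Omega>. f \<omega> ` D \<inter> G = {}} + h = card \<Omega>"
    unfolding h_def using finite_space by (subst card_Un_disjoint[symmetric]) (auto intro!: arg_cong[of _ _ card])
  then have "real (card {\<omega>\<in>\<Omega>. f \<omega> ` D \<inter> G = {}}) = W - real h" by (simp add: W_def)
  then have "real (card {\<omega>\<in>\<Omega>. f \<omega> ` D \<inter> G = {}}) * (1 + \<kappa>) = (W - real h) * (1 + \<kappa>)"
    by simp
  also have "\<dots> = W + W * \<kappa> - real h * (1 + \<kappa>)"
    by (simp add: algebra_simps)
  also have "\<dots> \<le> W" using hlow by simp
  finally show ?thesis using \<kappa> by (simp add: W_def pos_le_divide_eq)
qed

end

section \<open>Random affine bijections\<close>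

lemma bij_betw_list_of_vec: "bij_betw list_of_vec (carrier_vec n :: 'a Matrix.vec set) {xs. length xs = n}"
proof (rule bij_betw_imageI)
  show "inj_on list_of_vec (carrier_vec n :: 'a Matrix.vec set)" by (metis inj_onI vec_list)
  show "list_of_vec ` carrier_vec n = {xs :: 'a list. length xs = n}"
  proof safe
    fix xs :: "'a list"
    have "xs = list_of_vec (vec_of_list xs)" by (simp add: list_vec)
    then show "xs \<in> list_of_vec ` carrier_vec (length xs)"
      by (metis carrier_vec_dim_vec dim_vec_of_list imageI)
  qed (simp add: carrier_vecD)
qed

lemma card_carrier_vec: "card (carrier_vec n :: 'a::finite Matrix.vec set) = CARD('a) ^ n"
  using bij_betw_same_card[OF bij_betw_list_of_vec[where ?'a='a, of n]]
    card_lists_length_eq[of "UNIV :: 'a set" n] by simp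

lemma finite_carrier_vec [simp]: "finite (carrier_vec n :: 'a::finite Matrix.vec set)"
  by (rule card_ge_0_finite) (simp add: card_carrier_vec)

section \<open>Invertible matrices and their action on nonzero vectors\<close>

definition invertible_mats :: "nat \<Rightarrow> 'a::field mat set" where
  "invertible_mats n = {A \<in> carrier_mat n n. invertible_mat A}"

lemma invertible_mats_iff:
  "A \<in> invertible_mats n \<longleftrightarrow>
    A \<in> carrier_mat n n \<and> (\<exists>B\<in>carrier_mat n n. A * B = 1\<^sub>m n \<and> B * A = 1\<^sub>m n)"
proof
  assume "A \<in> invertible_mats n"
  then obtain B where A: "A \<in> carrier_mat n n" and B: "A * B = 1\<^sub>m n" "B * A = 1\<^sub>m (dim_row B)"
    unfolding invertible_mats_def invertible_mat_def inverts_mat_def by auto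
  \<comment> \<open>\<open>inverts_mat\<close> does not fix the shape of \<open>B\<close>; its
    dimensions are read off from the two products.\<close>
  have "dim_col B = n" using arg_cong[OF B(1), of dim_col] by simp
  moreover have "dim_row B = n" using arg_cong[OF B(2), of dim_col] A by simp
  ultimately show "A \<in> carrier_mat n n \<and> (\<exists>B\<in>carrier_mat n n. A * B = 1\<^sub>m n \<and> B * A = 1\<^sub>m n)"
    using A B by auto
qed (auto simp: invertible_mats_def invertible_mat_def inverts_mat_def)

lemma invertible_mats_carrier: "A \<in> invertible_mats n \<Longrightarrow> A \<in> carrier_mat n n"
  by (simp add: invertible_mats_def)

lemma invertible_mats_mult:
  assumes "A \<in> invertible_mats n" "B \<in> invertible_mats n"
  shows "A * B \<in> invertible_mats n"
proof -
  obtain A' B' where c: "A \<in> carrier_mat n n" "B \<in> carrier_mat n n" "A' \<in> carrier_mat n n" "B' \<in> carrier_mat n n"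
    and i: "A * A' = 1\<^sub>m n" "A' * A = 1\<^sub>m n" "B * B' = 1\<^sub>m n" "B' * B = 1\<^sub>m n"
    using assms unfolding invertible_mats_iff by blast
  have "(A * B) * (B' * A') = A * (B * B') * A'"
    using c by (simp add: assoc_mult_mat[of _ n n _ n _ n])
  moreover have "(B' * A') * (A * B) = B' * (A' * A) * B"
    using c by (simp add: assoc_mult_mat[of _ n n _ n _ n])
  ultimately show ?thesis unfolding invertible_mats_iff using c i
    by (intro conjI bexI[of _ "B' * A'"]) (auto simp: right_mult_one_mat)
qed

lemma invertible_mats_inj:
  assumes "A \<in> invertible_mats n" "v \<in> carrier_vec n" "w \<in> carrier_vec n" "A *\<^sub>v v = A *\<^sub>v w"
  shows "v = w"
proof -
  obtain B where c: "A \<in> carrier_mat n n" "B \<in> carrier_mat n n" "B * A = 1\<^sub>m n"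
    using assms unfolding invertible_mats_iff by blast
  have "B *\<^sub>v (A *\<^sub>v v) = v" "B *\<^sub>v (A *\<^sub>v w) = w"
    using assoc_mult_mat_vec[OF c(2,1) assms(2)] assoc_mult_mat_vec[OF c(2,1) assms(3)] c assms(2,3) by simp_all
  then show ?thesis using assms(4) by metis
qed

lemma one_invertible_mats: "1\<^sub>m n \<in> invertible_mats n"
  unfolding invertible_mats_iff by (intro conjI bexI[of _ "1\<^sub>m n"]) auto

lemma finite_carrier_mat: "finite (carrier_mat m n :: 'a::finite mat set)"
proof (rule finite_subset)
  show "finite (mat_of_cols m ` {es :: 'a Matrix.vec list. set es \<subseteq> carrier_vec m \<and> length es = n})"
    by (intro finite_imageI finite_lists_length_eq finite_carrier_vec)
  show "carrier_mat m n \<subseteq> mat_of_cols m ` {es :: 'a Matrix.vec list. set es \<subseteq> carrier_vec m \<and> length es = n}"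
  proof
    fix A :: "'a mat" assume A: "A \<in> carrier_mat m n"
    then have "A = mat_of_cols m (cols A)" using mat_of_cols_cols[of A] by simp
    moreover have "cols A \<in> {es. set es \<subseteq> carrier_vec m \<and> length es = n}" using A cols_dim[of A] by auto
    ultimately show "A \<in> mat_of_cols m ` {es. set es \<subseteq> carrier_vec m \<and> length es = n}" by blast
  qed
qed

lemma finite_invertible_mats: "finite (invertible_mats n :: 'a::{field,finite} mat set)"
  by (rule finite_subset[OF _ finite_carrier_mat[of n n]]) (auto simp: invertible_mats_def)

text \<open>The rank-one perturbation I + u e_k^T of the identity. It fixes every vector whose
  coordinate k vanishes, so one further image determines it.\<close>

definition shear :: "nat \<Rightarrow> nat \<Rightarrow> 'a::field Matrix.vec \<Rightarrow> 'a mat" where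
  "shear n k u = mat n n (\<lambda>(i, j). (if i = j then 1 else 0) + (if j = k then u $ i else 0))"

lemma shear_mult_vec:
  assumes "k < n" "u \<in> carrier_vec n" "v \<in> carrier_vec n"
  shows "shear n k u *\<^sub>v v = v + v $ k \<cdot>\<^sub>v u"
proof (rule eq_vecI)
  fix i assume "i < dim_vec (v + v $ k \<cdot>\<^sub>v u)"
  then have i: "i < n" using assms by simp
  have "(shear n k u *\<^sub>v v) $ i = (\<Sum>j = 0..<n. ((if i = j then 1 else 0) + (if j = k then u $ i else 0)) * v $ j)"
    using i assms by (simp add: shear_def scalar_prod_def)
  also have "\<dots> = (\<Sum>j = 0..<n. (if i = j then v $ j else 0) + (if j = k then u $ i * v $ j else 0))"
    by (intro sum.cong refl) (simp add: algebra_simps)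
  also have "\<dots> = v $ i + u $ i * v $ k"
    using i assms by (simp add: sum.distrib)
  finally show "(shear n k u *\<^sub>v v) $ i = (v + v $ k \<cdot>\<^sub>v u) $ i" using i assms by (simp add: mult.commute)
qed (use assms in \<open>simp add: shear_def\<close>)

lemma eq_matI_mult_vec:
  assumes "A \<in> carrier_mat m n" "B \<in> carrier_mat m n"
    and "\<And>v. v \<in> carrier_vec n \<Longrightarrow> A *\<^sub>v v = B *\<^sub>v (v :: 'a::field Matrix.vec)"
  shows "A = B"
proof (rule mat_col_eqI)
  fix j assume "j < dim_col B"
  then have j: "j < n" using assms by simp
  then have "A *\<^sub>v unit_vec n j = B *\<^sub>v unit_vec n j" using assms by simp
  moreover have "C *\<^sub>v unit_vec n j = col C j" if "C \<in> carrier_mat m n" for C :: "'a mat"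
    using that j by (intro eq_vecI) auto
  ultimately show "col A j = col B j" using assms by simp
qed (use assms in auto)

text \<open>The scaling by 1 / c_k makes the first shear send c to d; exchanging c and d gives the
  second, which sends d to c. Both fix the hyperplane v_k = 0, which spans the space together with
  d, so the product is the identity.\<close>

lemma shear_mult_shear:
  assumes k: "k < n" and c: "c \<in> carrier_vec n" "d \<in> carrier_vec n" and nz: "c $ k \<noteq> 0" "d $ k \<noteq> 0"
  shows "shear n k ((1 / c $ k) \<cdot>\<^sub>v (d - c)) * shear n k ((1 / d $ k) \<cdot>\<^sub>v (c - d)) = 1\<^sub>m n"
proof (rule eq_matI_mult_vec[of _ n n])
  have cu: "(1 / c $ k) \<cdot>\<^sub>v (d - c) \<in> carrier_vec n" "(1 / d $ k) \<cdot>\<^sub>v (c - d) \<in> carrier_vec n" using c by auto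
  have cs: "shear n k u \<in> carrier_mat n n" for u :: "'a Matrix.vec" by (simp add: shear_def)
  fix v :: "'a Matrix.vec" assume v: "v \<in> carrier_vec n"
  have v': "v + v $ k \<cdot>\<^sub>v ((1 / d $ k) \<cdot>\<^sub>v (c - d)) \<in> carrier_vec n" using v c by auto
  show "shear n k ((1 / c $ k) \<cdot>\<^sub>v (d - c)) * shear n k ((1 / d $ k) \<cdot>\<^sub>v (c - d)) *\<^sub>v v = 1\<^sub>m n *\<^sub>v v"
    unfolding assoc_mult_mat_vec[OF cs cs v] shear_mult_vec[OF k cu(2) v] shear_mult_vec[OF k cu(1) v']
    using v c k nz by (intro eq_vecI) (simp_all add: field_simps)
qed (auto simp: shear_def)

lemma shear_invertible:
  assumes k: "k < n" and c: "c \<in> carrier_vec n" "d \<in> carrier_vec n" and nz: "c $ k \<noteq> 0" "d $ k \<noteq> 0"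
  shows "shear n k ((1 / c $ k) \<cdot>\<^sub>v (d - c)) \<in> invertible_mats n"
  unfolding invertible_mats_iff
  using shear_mult_shear[OF assms] shear_mult_shear[OF k c(2,1) nz(2,1)]
  by (intro conjI bexI[of _ "shear n k ((1 / d $ k) \<cdot>\<^sub>v (c - d))"]) (auto simp: shear_def)

lemma shear_maps:
  assumes k: "k < n" and c: "c \<in> carrier_vec n" "d \<in> carrier_vec n" and nz: "c $ k \<noteq> 0"
  shows "shear n k ((1 / c $ k) \<cdot>\<^sub>v (d - c)) *\<^sub>v c = d"
  using assms by (subst shear_mult_vec) (auto intro!: eq_vecI simp: field_simps)

lemma nonzero_vec_index:
  assumes "c \<in> carrier_vec n" "c \<noteq> 0\<^sub>v n"
  obtains k where "k < n" "c $ k \<noteq> 0"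
  using assms by (metis carrier_vecD eq_vecI index_zero_vec)

text \<open>If \<open>c\<close> and \<open>d\<close> have no common nonzero coordinate, one passes through \<open>c + d\<close>.\<close>

lemma invertible_mats_transitive:
  assumes c: "c \<in> carrier_vec n" "c \<noteq> 0\<^sub>v n" and d: "d \<in> carrier_vec n" "d \<noteq> 0\<^sub>v n"
  obtains g where "g \<in> invertible_mats n" "g *\<^sub>v c = (d :: 'a::field Matrix.vec)"
proof (cases "\<exists>k<n. c $ k \<noteq> 0 \<and> d $ k \<noteq> 0")
  case True
  then show ?thesis using shear_invertible shear_maps that c d by metis
next
  case False
  obtain i j where ij: "i < n" "c $ i \<noteq> 0" "j < n" "d $ j \<noteq> 0"
    using c d nonzero_vec_index by metis
  define e where "e = c + d"
  have e: "e \<in> carrier_vec n" "e $ i \<noteq> 0" "e $ j \<noteq> 0"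
    using False c d ij by (auto simp: e_def)
  let ?g = "shear n i ((1 / c $ i) \<cdot>\<^sub>v (e - c))" and ?h = "shear n j ((1 / e $ j) \<cdot>\<^sub>v (d - e))"
  have "?h * ?g \<in> invertible_mats n"
    using ij e c d by (intro invertible_mats_mult shear_invertible) auto
  moreover have "?h * ?g *\<^sub>v c = d"
    using ij e c d shear_maps[of i n c e] shear_maps[of j n e d]
    by (subst assoc_mult_mat_vec[of _ n n _ n]) (auto simp: shear_def)
  ultimately show ?thesis using that by blast
qed

text \<open>The invertible matrices are partitioned by the image of \<open>y\<close>. Left
  multiplication by a matrix that sends d to e injects the class of d into the class of e, so by
  transitivity all card V - 1 classes have the same size.\<close>

lemma card_invertible_mats_maps:
  fixes y c :: "'a::{field,finite} Matrix.vec"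
  assumes y: "y \<in> carrier_vec n" "y \<noteq> 0\<^sub>v n" and c: "c \<in> carrier_vec n" "c \<noteq> 0\<^sub>v n"
  shows "card {A \<in> invertible_mats n. A *\<^sub>v y = c} * (card (carrier_vec n :: 'a Matrix.vec set) - 1) =
    card (invertible_mats n :: 'a mat set)"
proof -
  let ?M = "\<lambda>c. {A \<in> invertible_mats n :: 'a mat set. A *\<^sub>v y = c}"
  let ?V = "carrier_vec n - {0\<^sub>v n} :: 'a Matrix.vec set"
  have fin: "finite (?M c)" for c by (rule finite_subset[OF _ finite_invertible_mats]) auto
  have le: "card (?M d) \<le> card (?M e)" if d: "d \<in> ?V" and e: "e \<in> ?V" for d e
  proof -
    obtain g where g: "g \<in> invertible_mats n" "g *\<^sub>v d = e"
      using invertible_mats_transitive d e by (metis DiffE singletonI)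
    obtain h where h: "h \<in> carrier_mat n n" "h * g = 1\<^sub>m n" using g(1) unfolding invertible_mats_iff by auto
    show ?thesis
    proof (rule card_inj_on_le[OF _ _ fin])
      show "inj_on (\<lambda>A. g * A) (?M d)"
      proof (rule inj_onI)
        fix A B assume "A \<in> ?M d" "B \<in> ?M d" and eq: "g * A = g * B"
        then have AB: "A \<in> carrier_mat n n" "B \<in> carrier_mat n n" by (auto simp: invertible_mats_carrier)
        have "(h * g) * A = (h * g) * B"
          using assoc_mult_mat[OF h(1) invertible_mats_carrier[OF g(1)] AB(1)]
            assoc_mult_mat[OF h(1) invertible_mats_carrier[OF g(1)] AB(2)] eq by simp
        then show "A = B" using AB h by simp
      qed
      show "(\<lambda>A. g * A) ` ?M d \<subseteq> ?M e"
        using g y(1) by (auto intro: invertible_mats_mult simp: invertible_mats_carrier assoc_mult_mat_vec[of g n n _ n])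
    qed
  qed
  have "invertible_mats n = (\<Union>d\<in>?V. ?M d)"
  proof safe
    fix A :: "'a mat" assume A: "A \<in> invertible_mats n"
    have "A *\<^sub>v y \<noteq> 0\<^sub>v n"
    proof
      assume "A *\<^sub>v y = 0\<^sub>v n"
      also have "\<dots> = A *\<^sub>v 0\<^sub>v n" using invertible_mats_carrier[OF A] by auto
      finally show False using invertible_mats_inj[OF A y(1)] y(2) by simp
    qed
    then show "A \<in> (\<Union>d\<in>?V. ?M d)" using A y(1) invertible_mats_carrier[OF A] by auto
  qed
  then have "card (invertible_mats n :: 'a mat set) = card (\<Union>d\<in>?V. ?M d)" by simp
  also have "\<dots> = (\<Sum>d\<in>?V. card (?M d))"
    using fin by (intro card_UN_disjoint) auto
  also have "\<dots> = (\<Sum>d\<in>?V. card (?M c))"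
    using le c by (intro sum.cong refl antisym) auto
  also have "\<dots> = card (?M c) * (card (carrier_vec n :: 'a Matrix.vec set) - 1)"
    by (simp add: mult.commute)
  finally show ?thesis by simp
qed

text \<open>For fixed A exactly one translation b sends y to u, namely u - A y. With this b, y' goes
  to u' iff A sends the nonzero vector y' - y to the nonzero vector u' - u, which holds for a
  fraction 1 / (card V - 1) of all A.\<close>

lemma pairwise_uniform_affine:
  assumes "n \<ge> 1"
  shows "pairwise_uniform (invertible_mats n \<times> carrier_vec n) (carrier_vec n)
    (\<lambda>(A, b) y. A *\<^sub>v y + b :: 'a::{field,finite} Matrix.vec)"
proof
  let ?V = "carrier_vec n :: 'a Matrix.vec set" and ?GL = "invertible_mats n :: 'a mat set"
  show "finite (?GL \<times> ?V)" by (simp add: finite_invertible_mats)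
  show "?GL \<times> ?V \<noteq> {}" using one_invertible_mats zero_carrier_vec by blast
  show "finite ?V" by simp
  have "2 \<le> CARD('a)" using card_mono[of "UNIV::'a set" "{0,1}"] by simp
  also have "CARD('a) \<le> CARD('a) ^ n" using assms calculation by (intro self_le_power) auto
  finally show "2 \<le> card ?V" by (simp add: card_carrier_vec)
  show "(case \<omega> of (A, b) \<Rightarrow> \<lambda>y. A *\<^sub>v y + b) y \<in> ?V" if "\<omega> \<in> ?GL \<times> ?V" "y \<in> ?V" for \<omega> y
    using that by (auto intro!: add_carrier_vec mult_mat_vec_carrier[of _ n n] invertible_mats_carrier)
  show "inj_on (case \<omega> of (A, b) \<Rightarrow> \<lambda>y. A *\<^sub>v y + b) ?V" if mem: "\<omega> \<in> ?GL \<times> ?V" for \<omega>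
  proof -
    obtain A b where o: "\<omega> = (A, b)" "A \<in> ?GL" "b \<in> ?V" using mem by auto
    have "x = y" if "x \<in> ?V" "y \<in> ?V" "A *\<^sub>v x + b = A *\<^sub>v y + b" for x y
    proof -
      have "z = z'" if "z \<in> ?V" "z' \<in> ?V" "z + b = z' + b" for z z'
        using that o(3) by (auto simp: vec_eq_iff)
      then have "A *\<^sub>v x = A *\<^sub>v y"
        using that invertible_mats_carrier[OF o(2)] by simp
      then show ?thesis using invertible_mats_inj o that by blast
    qed
    then show ?thesis by (auto simp: o inj_on_def)
  qed
  have solve: "A *\<^sub>v y + b = u \<longleftrightarrow> b = u - A *\<^sub>v y" if "A \<in> ?GL" "b \<in> ?V" "y \<in> ?V" "u \<in> ?V" for A b y u
    using that invertible_mats_carrier[OF that(1)] by (auto intro!: eq_vecI simp: algebra_simps)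
  have sub: "u - A *\<^sub>v y \<in> ?V" if "A \<in> ?GL" "y \<in> ?V" "u \<in> ?V" for A y u
    using that invertible_mats_carrier[OF that(1)] by simp
  show "card {\<omega>\<in>?GL \<times> ?V. (case \<omega> of (A, b) \<Rightarrow> \<lambda>y. A *\<^sub>v y + b) y = u} * card ?V = card (?GL \<times> ?V)"
    if "y \<in> ?V" "u \<in> ?V" for y u
  proof -
    have "bij_betw (\<lambda>A. (A, u - A *\<^sub>v y)) ?GL {\<omega>\<in>?GL \<times> ?V. (case \<omega> of (A, b) \<Rightarrow> \<lambda>y. A *\<^sub>v y + b) y = u}"
    proof (rule bij_betw_imageI)
      show "inj_on (\<lambda>A. (A, u - A *\<^sub>v y)) ?GL" by (rule inj_onI) simp
      show "(\<lambda>A. (A, u - A *\<^sub>v y)) ` ?GL = {\<omega>\<in>?GL \<times> ?V. (case \<omega> of (A, b) \<Rightarrow> \<lambda>y. A *\<^sub>v y + b) y = u}"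
      proof -
        have "(A, b) \<in> (\<lambda>A. (A, u - A *\<^sub>v y)) ` ?GL \<longleftrightarrow> A \<in> ?GL \<and> b \<in> ?V \<and> A *\<^sub>v y + b = u" for A b
          using solve[of A b y u] sub[of A y u] that by blast
        then show ?thesis by auto
      qed
    qed
    then show ?thesis by (simp add: bij_betw_same_card[symmetric] card_cartesian_product)
  qed
  show "card {\<omega>\<in>?GL \<times> ?V. (case \<omega> of (A, b) \<Rightarrow> \<lambda>y. A *\<^sub>v y + b) y = u \<and>
      (case \<omega> of (A, b) \<Rightarrow> \<lambda>y. A *\<^sub>v y + b) y' = u'} * (card ?V * (card ?V - 1)) = card (?GL \<times> ?V)"
    if y: "y \<in> ?V" "y' \<in> ?V" "y \<noteq> y'" and u: "u \<in> ?V" "u' \<in> ?V" "u \<noteq> u'" for y y' u u'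
  proof -
    let ?M = "{A \<in> ?GL. A *\<^sub>v (y' - y) = u' - u}"
    have eq: "A *\<^sub>v (y' - y) = u' - u \<longleftrightarrow> A *\<^sub>v y' + (u - A *\<^sub>v y) = u'" if "A \<in> ?GL" for A
    proof -
      have A: "A \<in> carrier_mat n n" using that by (rule invertible_mats_carrier)
      have "A *\<^sub>v (y' - y) = A *\<^sub>v y' - A *\<^sub>v y" using A y by (intro mult_minus_distrib_mat_vec) auto
      moreover obtain z z' where "z = A *\<^sub>v y" "z' = A *\<^sub>v y'" "z \<in> ?V" "z' \<in> ?V" using A y by auto
      moreover have "z' - z = u' - u \<longleftrightarrow> z' + (u - z) = u'" if "z \<in> ?V" "z' \<in> ?V" for z z'
        using that u by (auto simp: vec_eq_iff algebra_simps)
      ultimately show ?thesis by simp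
    qed
    have "bij_betw (\<lambda>A. (A, u - A *\<^sub>v y)) ?M {\<omega>\<in>?GL \<times> ?V. (case \<omega> of (A, b) \<Rightarrow> \<lambda>y. A *\<^sub>v y + b) y = u \<and>
      (case \<omega> of (A, b) \<Rightarrow> \<lambda>y. A *\<^sub>v y + b) y' = u'}"
    proof (rule bij_betw_imageI)
      show "inj_on (\<lambda>A. (A, u - A *\<^sub>v y)) ?M" by (rule inj_onI) simp
      have "(A, b) \<in> (\<lambda>A. (A, u - A *\<^sub>v y)) ` ?M \<longleftrightarrow> (A, b) \<in> {\<omega>\<in>?GL \<times> ?V.
          (case \<omega> of (A, b) \<Rightarrow> \<lambda>y. A *\<^sub>v y + b) y = u \<and> (case \<omega> of (A, b) \<Rightarrow> \<lambda>y. A *\<^sub>v y + b) y' = u'}" for A b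
      proof -
        have "(A, b) \<in> (\<lambda>A. (A, u - A *\<^sub>v y)) ` ?M \<longleftrightarrow>
            A \<in> ?GL \<and> b = u - A *\<^sub>v y \<and> A *\<^sub>v (y' - y) = u' - u" by auto
        also have "\<dots> \<longleftrightarrow> A \<in> ?GL \<and> b \<in> ?V \<and> A *\<^sub>v y + b = u \<and> A *\<^sub>v y' + b = u'"
          using solve[of A b y u] eq[of A] sub[of A y u] y(1) u(1) by metis
        finally show ?thesis by simp
      qed
      then show "(\<lambda>A. (A, u - A *\<^sub>v y)) ` ?M = {\<omega>\<in>?GL \<times> ?V.
          (case \<omega> of (A, b) \<Rightarrow> \<lambda>y. A *\<^sub>v y + b) y = u \<and> (case \<omega> of (A, b) \<Rightarrow> \<lambda>y. A *\<^sub>v y + b) y' = u'}"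
        by auto
    qed
    moreover have "card ?M * (card ?V - 1) = card ?GL"
      using y u by (intro card_invertible_mats_maps) (auto simp: vec_eq_iff)
    ultimately show ?thesis by (simp add: bij_betw_same_card[symmetric] card_cartesian_product)
  qed
qed

section \<open>Independent repetition and medians\<close>

lemma prob_pair_pmf_Times:
  "measure_pmf.prob (pair_pmf A B) (X \<times> Y) = measure_pmf.prob A X * measure_pmf.prob B Y"
proof -
  have "emeasure (pair_pmf A B) (X \<times> Y) = (\<integral>\<^sup>+a. \<integral>\<^sup>+b. indicator X a * indicator Y b \<partial>B \<partial>A)"
    by (subst nn_integral_indicator[symmetric], simp)
      (simp add: nn_integral_pair_pmf' indicator_times)
  also have "\<dots> = emeasure A X * emeasure B Y"
    by (simp add: nn_integral_cmult nn_integral_multc)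
  finally show ?thesis by (simp add: measure_pmf.emeasure_eq_measure ennreal_mult[symmetric])
qed

lemma run_all_Cons:
  "run_all (p # ps) = map_pmf (\<lambda>((x, c), (xs, d)). (x # xs, c + d)) (pair_pmf p (run_all ps))"
  by (simp add: map_pmf_def pair_pmf_def bind_assoc_pmf bind_return_pmf case_prod_unfold)

lemma length_run_all: "(xs, d) \<in> set_pmf (run_all ps) \<Longrightarrow> length xs = length ps"
  by (induction ps arbitrary: xs d) auto

lemma calls_run_all:
  assumes "(xs, d) \<in> set_pmf (run_all ps)" "\<And>p x c. p \<in> set ps \<Longrightarrow> (x, c) \<in> set_pmf p \<Longrightarrow> c = k"
  shows "d = length ps * k"
  using assms by (induction ps arbitrary: xs d) (auto, blast)

text \<open>A union bound by induction: a bad list has a bad head or a bad tail. The predicate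
  depends on the position and is shifted when passing to the tail.\<close>

lemma prob_run_all_bad_le:
  assumes "\<And>i. i < length ps \<Longrightarrow> measure_pmf.prob (ps ! i) {(x, c). \<not> good i x} \<le> \<epsilon>"
  shows "measure_pmf.prob (run_all ps) {(xs, d). \<not> (\<forall>i<length ps. good i (xs ! i))} \<le> real (length ps) * \<epsilon>"
  using assms
proof (induction ps arbitrary: good)
  case (Cons p ps)
  let ?P = "pair_pmf p (run_all ps)"
  let ?X = "{(x, c). \<not> good 0 x}" and ?Y = "{(xs, d). \<not> (\<forall>i<length ps. good (Suc i) (xs ! i))}"
  have "measure_pmf.prob (run_all (p # ps)) {(xs, d). \<not> (\<forall>i<length (p # ps). good i (xs ! i))} =
      measure_pmf.prob ?P ((\<lambda>((x, c), (xs, d)). (x # xs, c + d)) -` {(xs, d). \<not> (\<forall>i<length (p # ps). good i (xs ! i))})"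
    by (simp only: run_all_Cons measure_map_pmf)
  also have "\<dots> \<le> measure_pmf.prob ?P (?X \<times> UNIV \<union> UNIV \<times> ?Y)"
    by (intro measure_pmf.finite_measure_mono) (auto simp: less_Suc_eq_0_disj)
  also have "\<dots> \<le> measure_pmf.prob ?P (?X \<times> UNIV) + measure_pmf.prob ?P (UNIV \<times> ?Y)"
    by (intro measure_Un_le) auto
  also have "\<dots> = measure_pmf.prob p ?X + measure_pmf.prob (run_all ps) ?Y"
    by (simp add: prob_pair_pmf_Times)
  also have "\<dots> \<le> \<epsilon> + real (length ps) * \<epsilon>"
    using Cons.prems[of 0] Cons.prems[of "Suc _"] by (intro add_mono Cons.IH) auto
  finally show ?case by (simp add: algebra_simps)
qed simp

text \<open>Chernoff's bound before \<theta> is optimised: the generating function of a binomial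
  variable at \<theta>, divided by \<theta>^k. The induction conditions on the first trial and
  passes from k to k - 1, hence the integer threshold; for k \<le> 0 the right-hand side has to
  dominate 1.\<close>

lemma prob_count_ge_le:
  fixes k :: int
  assumes B: "measure_pmf.prob p {(x, c). B x} \<le> \<beta>" and \<theta>: "1 \<le> \<theta>"
  shows "measure_pmf.prob (run_all (replicate l p)) {(xs, d). k \<le> int (length (filter B xs))}
    \<le> (1 - \<beta> + \<beta> * \<theta>) ^ l * \<theta> powi (- k)"
proof (induction l arbitrary: k)
  case 0
  have "1 \<le> \<theta> powi (- k)" if "k \<le> 0"
    using \<theta> that by (simp add: one_le_power_int)
  moreover have "0 \<le> \<theta> powi (- k)" using \<theta> by simp
  ultimately show ?case by (auto simp: indicator_def)
next
  case (Suc l)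
  let ?P = "pair_pmf p (run_all (replicate l p))"
  let ?X = "{(x, c). B x}" and ?Y = "\<lambda>k. {(xs, d). k \<le> int (length (filter B xs))}"
  define b where "b = measure_pmf.prob p ?X"
  have b: "0 \<le> b" "b \<le> 1" "b \<le> \<beta>" using B by (auto simp: b_def)
  have comp: "measure_pmf.prob p (- ?X) = 1 - b"
    using measure_pmf.prob_compl[of ?X p] by (simp add: b_def Compl_eq_Diff_UNIV)
  have "measure_pmf.prob (run_all (replicate (Suc l) p)) (?Y k) =
      measure_pmf.prob ?P ((\<lambda>((x, c), (xs, d)). (x # xs, c + d)) -` ?Y k)"
    by (simp only: run_all_Cons measure_map_pmf replicate_Suc)
  also have "\<dots> \<le> measure_pmf.prob ?P (?X \<times> ?Y (k - 1) \<union> (- ?X) \<times> ?Y k)"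
    by (intro measure_pmf.finite_measure_mono) (auto split: if_splits)
  also have "\<dots> \<le> measure_pmf.prob ?P (?X \<times> ?Y (k - 1)) + measure_pmf.prob ?P ((- ?X) \<times> ?Y k)"
    by (intro measure_Un_le) auto
  also have "\<dots> = b * measure_pmf.prob (run_all (replicate l p)) (?Y (k - 1)) +
      (1 - b) * measure_pmf.prob (run_all (replicate l p)) (?Y k)"
    by (simp add: prob_pair_pmf_Times b_def comp)
  also have "\<dots> \<le> b * ((1 - \<beta> + \<beta> * \<theta>) ^ l * \<theta> powi (- (k - 1))) + (1 - b) * ((1 - \<beta> + \<beta> * \<theta>) ^ l * \<theta> powi (- k))"
    using b by (intro add_mono mult_left_mono Suc.IH) auto
  also have "\<dots> = (1 + b * (\<theta> - 1)) * ((1 - \<beta> + \<beta> * \<theta>) ^ l * \<theta> powi (- k))"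
  proof -
    have "\<theta> powi (- (k - 1)) = \<theta> * \<theta> powi (- k)"
      using \<theta> power_int_add[of \<theta> 1 "- k"] by simp
    then show ?thesis by (simp add: algebra_simps)
  qed
  \<comment> \<open>The true probability b may be replaced by its bound \<beta> because \<theta> - 1
    is nonnegative.\<close>
  also have "\<dots> \<le> (1 + \<beta> * (\<theta> - 1)) * ((1 - \<beta> + \<beta> * \<theta>) ^ l * \<theta> powi (- k))"
  proof -
    have "0 \<le> 1 + \<beta> * (\<theta> - 1)" using b \<theta> by simp
    then have "0 \<le> 1 - \<beta> + \<beta> * \<theta>" by (simp add: algebra_simps)
    then show ?thesis using b \<theta> by (intro mult_right_mono add_left_mono mult_nonneg_nonneg zero_le_power) auto
  qed
  also have "\<dots> = (1 - \<beta> + \<beta> * \<theta>) ^ Suc l * \<theta> powi (- k)" by (simp add: algebra_simps)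
  finally show ?case .
qed

text \<open>Chernoff's bound at \<theta> = \<kappa>, the optimum for the threshold l / 2: it is the
  odds (1 - \<beta>) / \<beta> of \<beta> = 1 / (1 + \<kappa>). The base that results is 2 sqrt
  (\<beta> (1 - \<beta>)).\<close>

lemma prob_half_bad_le:
  assumes "measure_pmf.prob p {(x, c). B x} \<le> 1 / (1 + \<kappa>)" and "1 \<le> \<kappa>"
  shows "measure_pmf.prob (run_all (replicate l p)) {(xs, d). l \<le> 2 * length (filter B xs)}
    \<le> (2 * sqrt \<kappa> / (1 + \<kappa>)) ^ l"
proof -
  \<comment> \<open>Half of \<open>l\<close>, rounded up. From 2 k \<ge> l and 1 / sqrt \<kappa>
    \<le> 1 the rounding only helps.\<close>
  define k where "k = (l + 1) div 2"
  have "{(xs, d). l \<le> 2 * length (filter B xs)} = {(xs, d::nat). int k \<le> int (length (filter B xs))}"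
    by (auto simp: k_def)
  then have "measure_pmf.prob (run_all (replicate l p)) {(xs, d). l \<le> 2 * length (filter B xs)}
      \<le> (1 - 1 / (1 + \<kappa>) + 1 / (1 + \<kappa>) * \<kappa>) ^ l * \<kappa> powi (- int k)"
    using prob_count_ge_le[OF assms, of l "int k"] by simp
  also have "1 - 1 / (1 + \<kappa>) + 1 / (1 + \<kappa>) * \<kappa> = 2 * \<kappa> / (1 + \<kappa>)"
    using assms(2) by (simp add: divide_simps)
  also have "\<kappa> powi (- int k) \<le> (1 / sqrt \<kappa>) ^ l"
  proof -
    have "\<kappa> powi (- int k) = (1 / sqrt \<kappa>) ^ (2 * k)"
    proof -
      have "(1 / sqrt \<kappa>) ^ 2 = 1 / \<kappa>" using assms(2) by (simp add: power_divide)
      then show ?thesis by (simp add: power_mult power_int_minus power_one_over inverse_eq_divide)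
    qed
    also have "\<dots> \<le> (1 / sqrt \<kappa>) ^ l"
      using assms(2) by (intro power_decreasing) (auto simp: k_def)
    finally show ?thesis .
  qed
  then have "(2 * \<kappa> / (1 + \<kappa>)) ^ l * \<kappa> powi (- int k) \<le> (2 * \<kappa> / (1 + \<kappa>)) ^ l * (1 / sqrt \<kappa>) ^ l"
    using assms(2) by (intro mult_left_mono) auto
  also have "\<dots> = (2 * (\<kappa> / sqrt \<kappa>) / (1 + \<kappa>)) ^ l"
    by (simp add: power_mult_distrib[symmetric] mult.commute)
  also have "\<kappa> / sqrt \<kappa> = sqrt \<kappa>" using assms(2) by (simp add: real_div_sqrt)
  finally show ?thesis .
qed

section \<open>Medians and majorities\<close>

lemma length_filter_sort: "length (filter P (sort xs)) = length (filter P xs)"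
  by (metis mset_filter mset_sort size_mset)

text \<open>\<open>j\<close> is the position of the lower middle entry, which is at most the median;
  so the entries up to \<open>j\<close> lie below \<open>t\<close>. For even length these are
  exactly half of the list, which is why the bad event is "at least half" and not "more than
  half".\<close>

lemma median_less_count:
  assumes "xs \<noteq> []" "median xs < t"
  shows "length xs \<le> 2 * length (filter (\<lambda>x. x < t) xs)"
proof -
  let ?ys = "sort xs" and ?m = "length xs div 2"
  define j where "j = (if odd (length xs) then ?m else ?m - 1)"
  have pos: "0 < length xs" using assms by simp
  have jm: "?m < length xs" "j \<le> ?m" using pos by (auto simp: j_def)
  have "?ys ! j \<le> ?ys ! ?m" using jm by (intro sorted_nth_mono) auto
  then have "?ys ! j < t" using assms(2) by (auto simp: median_def j_def Let_def split: if_splits)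
  then have "{..j} \<subseteq> {i. i < length ?ys \<and> ?ys ! i < t}"
    using jm sorted_nth_mono[of ?ys _ j] by fastforce
  then have "card {..j} \<le> card {i. i < length ?ys \<and> ?ys ! i < t}" by (intro card_mono) auto
  then have "Suc j \<le> length (filter (\<lambda>x. x < t) ?ys)" by (simp add: length_filter_conv_card)
  then have "Suc j \<le> length (filter (\<lambda>x. x < t) xs)" by (simp only: length_filter_sort)
  moreover have "length xs \<le> 2 * Suc j" using pos by (auto simp: j_def elim: oddE)
  ultimately show ?thesis by (meson le_trans mult_le_mono2)
qed

lemma median_greater_count:
  assumes "xs \<noteq> []" "t < median xs"
  shows "length xs \<le> 2 * length (filter (\<lambda>x. t < x) xs)"
proof -
  let ?ys = "sort xs" and ?m = "length xs div 2"
  have pos: "0 < length xs" using assms by simp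
  have "?ys ! (?m - 1) \<le> ?ys ! ?m" using pos by (intro sorted_nth_mono) auto
  then have "t < ?ys ! ?m" using assms(2) by (auto simp: median_def Let_def split: if_splits)
  then have "{?m..<length xs} \<subseteq> {i. i < length ?ys \<and> t < ?ys ! i}"
    using sorted_nth_mono[of ?ys ?m] by fastforce
  then have "card {?m..<length xs} \<le> card {i. i < length ?ys \<and> t < ?ys ! i}" by (intro card_mono) auto
  then have "length xs - ?m \<le> length (filter (\<lambda>x. t < x) ?ys)" by (simp add: length_filter_conv_card)
  then have "length xs - ?m \<le> length (filter (\<lambda>x. t < x) xs)" by (simp only: length_filter_sort)
  then show ?thesis by linarith
qed

lemma mb_wish_level_map:
  "mb_wish_level \<alpha> r n w l i = map_pmf (\<lambda>(ws, c). (median ws, c)) (run_all (replicate l (mb_wish_sample \<alpha> r n w i)))"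
  by (simp add: mb_wish_level_def map_pmf_def case_prod_unfold)

lemma prob_level_bad_le:
  assumes lo: "measure_pmf.prob (mb_wish_sample \<alpha> r n w i) {(x, c). x < a} \<le> 1 / (1 + \<kappa>)"
    and hi: "measure_pmf.prob (mb_wish_sample \<alpha> r n w i) {(x, c). b < x} \<le> 1 / (1 + \<kappa>)"
    and \<kappa>: "1 \<le> \<kappa>" and l: "l \<ge> 1"
  shows "measure_pmf.prob (mb_wish_level \<alpha> r n w l i) {(x, c). \<not> (a \<le> x \<and> x \<le> b)}
    \<le> 2 * (2 * sqrt \<kappa> / (1 + \<kappa>)) ^ l"
proof -
  let ?R = "run_all (replicate l (mb_wish_sample \<alpha> r n w i))"
  let ?A = "{(xs, d). l \<le> 2 * length (filter (\<lambda>x. x < a) xs)}" and ?B = "{(xs, d). l \<le> 2 * length (filter (\<lambda>x. b < x) xs)}"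
  have "measure_pmf.prob (mb_wish_level \<alpha> r n w l i) {(x, c). \<not> (a \<le> x \<and> x \<le> b)} =
      measure_pmf.prob ?R {(ws, c). \<not> (a \<le> median ws \<and> median ws \<le> b)}"
    unfolding mb_wish_level_map measure_map_pmf by (rule arg_cong[of _ _ "measure_pmf.prob ?R"]) auto
  also have "\<dots> \<le> measure_pmf.prob ?R (?A \<union> ?B)"
  proof (intro measure_pmf.finite_measure_mono_AE AE_pmfI impI)
    fix y assume y: "y \<in> set_pmf ?R" "y \<in> {(ws, c). \<not> (a \<le> median ws \<and> median ws \<le> b)}"
    obtain xs d where [simp]: "y = (xs, d)" by (cases y)
    have "length xs = l" using length_run_all y(1) by fastforce
    moreover have "xs \<noteq> []" using calculation l by auto
    ultimately show "y \<in> ?A \<union> ?B"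
      using y(2) median_less_count[of xs a] median_greater_count[of xs b] by (auto simp: not_le)
  qed auto
  also have "\<dots> \<le> measure_pmf.prob ?R ?A + measure_pmf.prob ?R ?B"
    by (intro measure_Un_le) auto
  also have "\<dots> \<le> (2 * sqrt \<kappa> / (1 + \<kappa>)) ^ l + (2 * sqrt \<kappa> / (1 + \<kappa>)) ^ l"
    by (intro add_mono prob_half_bad_le lo hi \<kappa>)
  finally show ?thesis by simp
qed

section \<open>Decreasing sequences and geometric blocks\<close>

text \<open>The integral over \<open>[0, x]\<close> of the step function with value \<open>a j\<close> on \<open>[j, j + 1)\<close>.\<close>

definition step_integral :: "(nat \<Rightarrow> real) \<Rightarrow> nat \<Rightarrow> real \<Rightarrow> real" where
  "step_integral a N x = (\<Sum>j<N. a j * max 0 (min 1 (x - real j)))"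

text \<open>Each summand is the length of the overlap of [0, x] with [j, j + 1), and these intervals
  tile [0, N).\<close>

lemma sum_clamp:
  fixes x :: real
  assumes "0 \<le> x" "x \<le> real N"
  shows "(\<Sum>j<N. max 0 (min 1 (x - real j))) = x"
  using assms
proof (induction N)
  case (Suc N)
  show ?case
  proof (cases "x \<le> real N")
    case True
    then show ?thesis using Suc by simp
  next
    case False
    have "(\<Sum>j<N. max 0 (min 1 (x - real j))) = (\<Sum>j<N. 1)"
      using False by (intro sum.cong) auto
    then show ?thesis using False Suc.prems by simp
  qed
qed simp

lemma step_integral_full: "real N \<le> x \<Longrightarrow> step_integral a N x = (\<Sum>j<N. a j)"
  unfolding step_integral_def by (intro sum.cong) auto

lemma step_integral_one:
  assumes "0 < N"
  shows "step_integral a N 1 = a 0"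
proof -
  obtain M where [simp]: "N = Suc M" using assms by (cases N) auto
  show ?thesis unfolding step_integral_def by (simp add: sum.lessThan_Suc_shift del: sum.lessThan_Suc)
qed

text \<open>A decreasing function is at most its value at the left end of [x, y].\<close>

lemma step_integral_diff_le:
  assumes anti: "antimono a" and nn: "\<And>j. 0 \<le> a j" and xy: "0 \<le> x" "x \<le> y"
  shows "step_integral a N y - step_integral a N x \<le> (y - x) * a (nat \<lfloor>x\<rfloor>)"
proof -
  \<comment> \<open>Summing up to \<open>M\<close> instead of \<open>N\<close> makes the overlaps
    add up to all of y - x even if y exceeds N.\<close>
  define M where "M = max N (nat \<lceil>y\<rceil>)"
  have "y \<le> real M" unfolding M_def using xy by linarith
  define c where "c x j = max 0 (min 1 (x - real j))" for x j
  have mono: "c x j \<le> c y j" for j using xy by (auto simp: c_def)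
  have "step_integral a N y - step_integral a N x = (\<Sum>j<N. a j * (c y j - c x j))"
    unfolding step_integral_def c_def by (simp add: sum_subtractf algebra_simps)
  also have "\<dots> \<le> (\<Sum>j<N. a (nat \<lfloor>x\<rfloor>) * (c y j - c x j))"
  proof (intro sum_mono)
    fix j
    show "a j * (c y j - c x j) \<le> a (nat \<lfloor>x\<rfloor>) * (c y j - c x j)"
    proof (cases "nat \<lfloor>x\<rfloor> \<le> j")
      case True
      then show ?thesis using anti mono by (intro mult_right_mono) (auto dest: antimonoD)
    next
      case False
      then have "real j + 1 \<le> x" using xy by linarith
      then have "c y j = c x j" using xy by (auto simp: c_def)
      then show ?thesis by simp
    qed
  qed
  also have "\<dots> = a (nat \<lfloor>x\<rfloor>) * (\<Sum>j<N. c y j - c x j)" by (simp add: sum_distrib_left)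
  also have "(\<Sum>j<N. c y j - c x j) \<le> (\<Sum>j<M. c y j - c x j)"
    using mono by (intro sum_mono2) (auto simp: M_def)
  then have "a (nat \<lfloor>x\<rfloor>) * (\<Sum>j<N. c y j - c x j) \<le> a (nat \<lfloor>x\<rfloor>) * (\<Sum>j<M. c y j - c x j)"
    using nn by (intro mult_left_mono) auto
  also have "(\<Sum>j<M. c y j - c x j) = y - x"
    using \<open>y \<le> real M\<close> xy by (simp add: c_def sum_subtractf sum_clamp)
  finally show ?thesis by (simp add: mult.commute)
qed

text \<open>Here the right end counts: \<lceil>y\<rceil> - 1 is the index of the step just left of
  y. As \<open>a\<close> vanishes from \<open>N\<close> on, extending the sum to \<open>M\<close>
  does not change it.\<close>

lemma step_integral_diff_ge:
  assumes anti: "antimono a" and nn: "\<And>j. 0 \<le> a j" and zero: "\<And>j. N \<le> j \<Longrightarrow> a j = 0"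
    and xy: "0 \<le> x" "x \<le> y"
  shows "(y - x) * a (nat \<lceil>y\<rceil> - 1) \<le> step_integral a N y - step_integral a N x"
proof -
  define M where "M = max N (nat \<lceil>y\<rceil>)"
  have "y \<le> real M" unfolding M_def using xy by linarith
  define c where "c x j = max 0 (min 1 (x - real j))" for x j
  have mono: "c x j \<le> c y j" for j using xy by (auto simp: c_def)
  have "(y - x) = (\<Sum>j<M. c y j - c x j)"
    using \<open>y \<le> real M\<close> xy by (simp add: c_def sum_subtractf sum_clamp)
  then have "(y - x) * a (nat \<lceil>y\<rceil> - 1) = (\<Sum>j<M. a (nat \<lceil>y\<rceil> - 1) * (c y j - c x j))"
    by (simp add: sum_distrib_left mult.commute)
  also have "\<dots> \<le> (\<Sum>j<M. a j * (c y j - c x j))"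
  proof (intro sum_mono)
    fix j
    show "a (nat \<lceil>y\<rceil> - 1) * (c y j - c x j) \<le> a j * (c y j - c x j)"
    proof (cases "j \<le> nat \<lceil>y\<rceil> - 1")
      case True
      then show ?thesis using anti mono by (intro mult_right_mono) (auto dest: antimonoD)
    next
      case False
      then have "y \<le> real j" by linarith
      then have "c y j = c x j" using xy by (auto simp: c_def)
      then show ?thesis by simp
    qed
  qed
  also have "\<dots> = (\<Sum>j<N. a j * (c y j - c x j))"
    using zero by (intro sum.mono_neutral_right) (auto simp: M_def)
  also have "\<dots> = step_integral a N y - step_integral a N x"
    unfolding step_integral_def c_def by (simp add: sum_subtractf algebra_simps)
  finally show ?thesis .
qed

text \<open>Continuing the values by 0 beyond \<open>N\<close> keeps the quantile at rank \<kappa>^i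
  meaningful when \<kappa>^i exceeds \<open>N\<close>.\<close>

locale decreasing_values =
  fixes a :: "nat \<Rightarrow> real" and N :: nat and \<kappa> :: real
  assumes anti: "antimono a" and nn: "\<And>j. 0 \<le> a j" and zero: "\<And>j. N \<le> j \<Longrightarrow> a j = 0"
    and N: "0 < N" and \<kappa>: "1 < \<kappa>"
begin

lemma power_diff: "\<kappa> ^ Suc i - \<kappa> ^ i = (\<kappa> - 1) * \<kappa> ^ i"
  by (simp add: algebra_simps)

lemma powers_mono: "0 \<le> \<kappa> ^ i" "\<kappa> ^ i \<le> \<kappa> ^ Suc i"
  using \<kappa> by (simp_all add: power_increasing del: power_Suc)

text \<open>[0, \<kappa>^m] is cut into [0, 1] and the blocks [\<kappa>^i, \<kappa>^(i + 1)], whose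
  lengths (\<kappa> - 1) \<kappa>^i are the weights in the output of the algorithm. The two bounds
  below take each block at its left and at its right end.\<close>

lemma telescope:
  "step_integral a N (\<kappa> ^ m) = a 0 + (\<Sum>i<m. step_integral a N (\<kappa> ^ Suc i) - step_integral a N (\<kappa> ^ i))"
  unfolding sum_lessThan_telescope[of "\<lambda>i. step_integral a N (\<kappa> ^ i)" m]
  using step_integral_one[OF N, of a] by simp

lemma sum_le_blocks:
  assumes "real N \<le> \<kappa> ^ m"
  shows "(\<Sum>j<N. a j) \<le> a 0 + (\<kappa> - 1) * (\<Sum>i<m. \<kappa> ^ i * a (nat \<lfloor>\<kappa> ^ i\<rfloor>))"
proof -
  have "(\<Sum>j<N. a j) = a 0 + (\<Sum>i<m. step_integral a N (\<kappa> ^ Suc i) - step_integral a N (\<kappa> ^ i))"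
    by (simp only: telescope[symmetric] step_integral_full[OF assms])
  also have "\<dots> \<le> a 0 + (\<Sum>i<m. (\<kappa> ^ Suc i - \<kappa> ^ i) * a (nat \<lfloor>\<kappa> ^ i\<rfloor>))"
    by (intro add_left_mono sum_mono step_integral_diff_le anti nn powers_mono)
  also have "\<dots> = a 0 + (\<kappa> - 1) * (\<Sum>i<m. \<kappa> ^ i * a (nat \<lfloor>\<kappa> ^ i\<rfloor>))"
    unfolding power_diff by (simp add: sum_distrib_left mult.assoc)
  finally show ?thesis .
qed

lemma blocks_le_sum:
  "a 0 + (\<kappa> - 1) * (\<Sum>i<m. \<kappa> ^ i * a (nat \<lceil>\<kappa> ^ Suc i\<rceil> - 1)) \<le> (\<Sum>j<N. a j)"
proof -
  have "a 0 + (\<kappa> - 1) * (\<Sum>i<m. \<kappa> ^ i * a (nat \<lceil>\<kappa> ^ Suc i\<rceil> - 1)) =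
      a 0 + (\<Sum>i<m. (\<kappa> ^ Suc i - \<kappa> ^ i) * a (nat \<lceil>\<kappa> ^ Suc i\<rceil> - 1))"
    unfolding power_diff by (simp add: sum_distrib_left mult.assoc)
  also have "\<dots> \<le> a 0 + (\<Sum>i<m. step_integral a N (\<kappa> ^ Suc i) - step_integral a N (\<kappa> ^ i))"
    by (intro add_left_mono sum_mono step_integral_diff_ge anti nn zero powers_mono)
  also have "\<dots> = step_integral a N (\<kappa> ^ m)" by (rule telescope[symmetric])
  also have "\<dots> \<le> (\<Sum>j<N. a j)"
    unfolding step_integral_def using nn by (intro sum_mono mult_left_le) auto
  finally show ?thesis .
qed

text \<open>Compares the step function just right of x with its value just left of x; they can
  differ only at integral x.\<close>

lemma floor_le_ceiling: "a (nat \<lfloor>x\<rfloor>) \<le> a (nat \<lceil>x\<rceil> - 1)" for x :: real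
proof (rule antimonoD[OF anti])
  have "\<lceil>x\<rceil> \<le> \<lfloor>x\<rfloor> + 1" by linarith
  then show "nat \<lceil>x\<rceil> - 1 \<le> nat \<lfloor>x\<rfloor>" by linarith
qed

text \<open>Here \<open>M i\<close> plays the role of \<open>M\<^sub>i\<^sub>+\<^sub>1\<close>. The upper quantile bound is two levels off, which costs
  the same factor \<open>\<kappa>\<^sup>2\<close> as the lower bound that is one level off.\<close>

lemma estimate_upper:
  assumes M: "\<And>i. i < m \<Longrightarrow> M i \<le> a (if i = 0 then 0 else nat \<lfloor>\<kappa> ^ (i - 1)\<rfloor>)"
  shows "a 0 + (\<kappa> - 1) * (\<Sum>i<m. M i * \<kappa> ^ i) \<le> \<kappa>\<^sup>2 * (\<Sum>j<N. a j)"
proof -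
  let ?S = "\<Sum>j<N. a j" and ?c = "\<lambda>i. a (nat \<lceil>\<kappa> ^ Suc i\<rceil> - 1)"
  let ?T = "\<Sum>i<m. \<kappa> ^ i * ?c i"
  have T: "a 0 + (\<kappa> - 1) * ?T \<le> ?S" by (rule blocks_le_sum)
  have "(\<Sum>i<m. M i * \<kappa> ^ i) \<le> (\<Sum>i<m. a (if i = 0 then 0 else nat \<lfloor>\<kappa> ^ (i - 1)\<rfloor>) * \<kappa> ^ i)"
    using M \<kappa> by (intro sum_mono mult_right_mono) auto
  \<comment> \<open>Two more terms are added so that, after the first two are split off, the shift
    by two levels leaves a sum over the original range.\<close>
  also have "\<dots> \<le> (\<Sum>i<Suc (Suc m). a (if i = 0 then 0 else nat \<lfloor>\<kappa> ^ (i - 1)\<rfloor>) * \<kappa> ^ i)"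
    using nn \<kappa> by (intro sum_mono2) auto
  also have "\<dots> = a 0 + \<kappa> * a 1 + (\<Sum>i<m. a (nat \<lfloor>\<kappa> ^ Suc i\<rfloor>) * \<kappa> ^ Suc (Suc i))"
    by (simp only: sum.lessThan_Suc_shift) (simp add: mult_ac)
  also have "\<dots> \<le> a 0 + \<kappa> * a 0 + (\<Sum>i<m. ?c i * \<kappa> ^ Suc (Suc i))"
    using \<kappa> anti floor_le_ceiling
    by (intro add_mono sum_mono mult_left_mono mult_right_mono order_refl) (auto dest: antimonoD)
  also have "(\<Sum>i<m. ?c i * \<kappa> ^ Suc (Suc i)) = \<kappa>\<^sup>2 * ?T"
    by (simp add: sum_distrib_left power2_eq_square mult_ac)
  finally have "(\<kappa> - 1) * (\<Sum>i<m. M i * \<kappa> ^ i) \<le> (\<kappa> - 1) * (a 0 + \<kappa> * a 0 + \<kappa>\<^sup>2 * ?T)"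
    using \<kappa> by (intro mult_left_mono) auto
  \<comment> \<open>The coefficient of \<open>a 0\<close> is 1 + (\<kappa> - 1) (1 + \<kappa>) =
    \<kappa>^2, so the two split-off terms fit exactly into the factor \<kappa>^2.\<close>
  then have "a 0 + (\<kappa> - 1) * (\<Sum>i<m. M i * \<kappa> ^ i) \<le> \<kappa>\<^sup>2 * (a 0 + (\<kappa> - 1) * ?T)"
    by (simp add: algebra_simps power2_eq_square)
  also have "\<dots> \<le> \<kappa>\<^sup>2 * ?S" using T by (intro mult_left_mono) auto
  finally show ?thesis .
qed

text \<open>\<open>M i\<close> bounds the block that starts at \<kappa>^(i + 2), whose length is
  \<kappa>^2 times the weight of \<open>M i\<close>. One factor \<kappa> would be lost even for
  exact quantiles, since a block is bounded by its left end; the other is the level by which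
  \<open>M i\<close> is off. Right ends lose nothing, which leaves room for two levels in the upper
  bound.\<close>

lemma estimate_lower:
  assumes Nm: "real N \<le> \<kappa> ^ m" and M: "\<And>i. i < m \<Longrightarrow> a (nat \<lceil>\<kappa> ^ (i + 2)\<rceil> - 1) \<le> M i"
  shows "(\<Sum>j<N. a j) / \<kappa>\<^sup>2 \<le> a 0 + (\<kappa> - 1) * (\<Sum>i<m. M i * \<kappa> ^ i)"
proof -
  let ?S = "\<Sum>j<N. a j"
  let ?f = "\<lambda>i. \<kappa> ^ i * a (nat \<lfloor>\<kappa> ^ i\<rfloor>)"
  let ?Z = "\<Sum>i<m. M i * \<kappa> ^ i"
  have "(\<Sum>i<m. ?f i) \<le> (\<Sum>i<Suc (Suc m). ?f i)"
    using nn \<kappa> by (intro sum_mono2) auto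
  also have "\<dots> = a 1 + \<kappa> * a (nat \<lfloor>\<kappa>\<rfloor>) + (\<Sum>i<m. ?f (Suc (Suc i)))"
    by (simp only: sum.lessThan_Suc_shift) simp
  also have "\<dots> \<le> a 0 + \<kappa> * a 0 + (\<Sum>i<m. \<kappa>\<^sup>2 * (M i * \<kappa> ^ i))"
  proof (intro add_mono sum_mono)
    show "a 1 \<le> a 0" "\<kappa> * a (nat \<lfloor>\<kappa>\<rfloor>) \<le> \<kappa> * a 0" using anti \<kappa> by (auto dest: antimonoD)
    fix i assume "i \<in> {..<m}"
    then have "a (nat \<lfloor>\<kappa> ^ (i + 2)\<rfloor>) \<le> M i" using M floor_le_ceiling order_trans by blast
    then have "\<kappa> ^ (i + 2) * a (nat \<lfloor>\<kappa> ^ (i + 2)\<rfloor>) \<le> \<kappa> ^ (i + 2) * M i"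
      using \<kappa> by (intro mult_left_mono) auto
    then show "?f (Suc (Suc i)) \<le> \<kappa>\<^sup>2 * (M i * \<kappa> ^ i)" by (simp add: power2_eq_square mult_ac)
  qed
  also have "(\<Sum>i<m. \<kappa>\<^sup>2 * (M i * \<kappa> ^ i)) = \<kappa>\<^sup>2 * ?Z" by (simp add: sum_distrib_left)
  finally have "(\<kappa> - 1) * (\<Sum>i<m. ?f i) \<le> (\<kappa> - 1) * (a 0 + \<kappa> * a 0 + \<kappa>\<^sup>2 * ?Z)"
    using \<kappa> by (intro mult_left_mono) auto
  then have "?S \<le> a 0 + (\<kappa> - 1) * (a 0 + \<kappa> * a 0 + \<kappa>\<^sup>2 * ?Z)"
    using sum_le_blocks[OF Nm] by simp
  also have "\<dots> = \<kappa>\<^sup>2 * (a 0 + (\<kappa> - 1) * ?Z)" by (simp add: algebra_simps power2_eq_square)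
  finally have "?S \<le> \<kappa>\<^sup>2 * (a 0 + (\<kappa> - 1) * ?Z)" .
  moreover have "0 < \<kappa>\<^sup>2" using \<kappa> by simp
  ultimately show ?thesis by (simp only: pos_divide_le_eq mult.commute)
qed

end

lemma decreasing_enumeration:
  fixes w :: "'b \<Rightarrow> real"
  assumes "finite V"
  obtains f where "bij_betw f {..<card V} V" "\<And>i j. i \<le> j \<Longrightarrow> j < card V \<Longrightarrow> w (f j) \<le> w (f i)"
proof -
  obtain xs where xs: "set xs = V" "distinct xs" using assms finite_distinct_list by blast
  define ys where "ys = sort_key (\<lambda>x. - w x) xs"
  have ys: "set ys = V" "distinct ys" "length ys = card V" "sorted (map (\<lambda>x. - w x) ys)"
    using xs distinct_card[OF xs(2)] by (auto simp: ys_def)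
  show ?thesis
  proof (rule that)
    show "bij_betw (\<lambda>i. ys ! i) {..<card V} V" by (rule bij_betw_nth) (use ys in auto)
    show "w (ys ! j) \<le> w (ys ! i)" if "i \<le> j" "j < card V" for i j
      using sorted_nth_mono[OF ys(4), of i j] that ys(3) by simp
  qed
qed

section \<open>Lexicographic prefixes\<close>

text \<open>Rank is strictly increasing along a strict linear order, hence injective, and its range
  is confined to a set of the same size as \<open>V\<close>.\<close>

lemma rank_bij_betw:
  assumes "finite V" and irrefl: "\<And>x. x \<in> V \<Longrightarrow> \<not> R x x"
    and trans: "\<And>x y z. x \<in> V \<Longrightarrow> y \<in> V \<Longrightarrow> z \<in> V \<Longrightarrow> R x y \<Longrightarrow> R y z \<Longrightarrow> R x z"
    and total: "\<And>x y. x \<in> V \<Longrightarrow> y \<in> V \<Longrightarrow> x \<noteq> y \<Longrightarrow> R x y \<or> R y x"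
  shows "bij_betw (\<lambda>s. card {x \<in> V. x = s \<or> R x s}) V {1..card V}"
proof -
  let ?rank = "\<lambda>s. card {x \<in> V. x = s \<or> R x s}"
  have less: "?rank s < ?rank t" if "s \<in> V" "t \<in> V" "R s t" for s t
  proof (rule psubset_card_mono)
    have "t \<noteq> s" "\<not> R t s" using that irrefl[of t] trans[of t s t] by auto
    then have "t \<in> {x \<in> V. x = t \<or> R x t} - {x \<in> V. x = s \<or> R x s}" using that by simp
    moreover have "{x \<in> V. x = s \<or> R x s} \<subseteq> {x \<in> V. x = t \<or> R x t}"
      using that trans[of _ s t] by auto
    ultimately show "{x \<in> V. x = s \<or> R x s} \<subset> {x \<in> V. x = t \<or> R x t}" by auto
  qed (use assms(1) in simp)
  have inj: "inj_on ?rank V"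
  proof (rule inj_onI)
    fix s t assume "s \<in> V" "t \<in> V" "?rank s = ?rank t"
    then show "s = t" using less[of s t] less[of t s] total[of s t] by auto
  qed
  have sub: "?rank ` V \<subseteq> {1..card V}"
  proof safe
    fix s assume s: "s \<in> V"
    have "?rank s \<le> card V" using assms(1) by (intro card_mono) auto
    moreover have "?rank s > 0" using s assms(1) by (auto simp: card_gt_0_iff)
    ultimately show "?rank s \<in> {1..card V}" by auto
  qed
  have "?rank ` V = {1..card V}"
    by (rule card_subset_eq[OF _ sub]) (simp_all add: card_image[OF inj])
  then show ?thesis using inj by (simp add: bij_betw_def)
qed

context
  fixes \<alpha> :: "nat \<Rightarrow> 'a::{field,finite}"
  assumes bij: "bij_betw \<alpha> {..<CARD('a)} UNIV"
begin

lemma field_order_iff: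
  assumes "a < CARD('a)" "b < CARD('a)"
  shows "(\<alpha> a, \<alpha> b) \<in> field_order \<alpha> \<longleftrightarrow> a < b"
proof
  assume "(\<alpha> a, \<alpha> b) \<in> field_order \<alpha>"
  then obtain a' b' where *: "\<alpha> a = \<alpha> a'" "\<alpha> b = \<alpha> b'" "a' < b'" "b' < CARD('a)"
    by (auto simp: field_order_def)
  have "a = a'" "b = b'"
    using inj_onD[OF bij_betw_imp_inj_on[OF bij] *(1)] inj_onD[OF bij_betw_imp_inj_on[OF bij] *(2)] * assms by auto
  then show "a < b" using * by simp
qed (use assms in \<open>auto simp: field_order_def\<close>)

lemma enum_cases:
  obtains i where "i < CARD('a)" "x = \<alpha> i"
  using bij by (metis UNIV_I bij_betw_imp_surj_on imageE lessThan_iff)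

lemma field_order_strict_linear:
  shows "(x, x) \<notin> field_order \<alpha>" "trans (field_order \<alpha>)"
    and "(x, y) \<in> field_order \<alpha> \<or> x = y \<or> (y, x) \<in> field_order \<alpha>"
proof -
  show "(x, x) \<notin> field_order \<alpha>" using field_order_iff by (metis enum_cases less_irrefl)
  show "trans (field_order \<alpha>)"
  proof (rule transI)
    fix x y z assume "(x, y) \<in> field_order \<alpha>" "(y, z) \<in> field_order \<alpha>"
    then show "(x, z) \<in> field_order \<alpha>"
      by (metis enum_cases field_order_iff less_trans)
  qed
  obtain i j where "i < CARD('a)" "x = \<alpha> i" "j < CARD('a)" "y = \<alpha> j" by (metis enum_cases)
  then show "(x, y) \<in> field_order \<alpha> \<or> x = y \<or> (y, x) \<in> field_order \<alpha>"
    using field_order_iff[of i j] field_order_iff[of j i] by (cases i j rule: linorder_cases) auto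
qed

text \<open>This makes the definite description in \<open>lex_nth\<close> denote for every position
  from 1 to q^n.\<close>

lemma lex_precedes_rank_bij:
  "bij_betw (\<lambda>s. card {x \<in> carrier_vec n. x = s \<or> lex_precedes \<alpha> x s})
    (carrier_vec n) {1..CARD('a) ^ n}"
proof -
  \<comment> \<open>\<open>lex\<close> compares lists of equal length only; on vectors of one
    dimension it agrees with \<open>lexord\<close>, which inherits totality and transitivity from
    the order of the entries.\<close>
  have lp: "lex_precedes \<alpha> x y \<longleftrightarrow> (list_of_vec x, list_of_vec y) \<in> lexord (field_order \<alpha>)"
    if "x \<in> carrier_vec n" "y \<in> carrier_vec n" for x y
    using that by (auto simp: lex_precedes_def lexord_lex)
  have "bij_betw (\<lambda>s. card {x \<in> carrier_vec n. x = s \<or> lex_precedes \<alpha> x s})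
      (carrier_vec n :: 'a Matrix.vec set) {1..card (carrier_vec n :: 'a Matrix.vec set)}"
  proof (rule rank_bij_betw)
    fix x y z :: "'a Matrix.vec"
    assume x: "x \<in> carrier_vec n"
    show "\<not> lex_precedes \<alpha> x x"
      unfolding lp[OF x x] using field_order_strict_linear(1) by (intro lexord_irreflexive) auto
    assume y: "y \<in> carrier_vec n"
    show "lex_precedes \<alpha> x y \<or> lex_precedes \<alpha> y x" if "x \<noteq> y"
    proof -
      have "total (field_order \<alpha>)" using field_order_strict_linear(3) by (auto simp: total_on_def)
      moreover have "list_of_vec x \<noteq> list_of_vec y" using that by (metis vec_list)
      ultimately show ?thesis unfolding lp[OF x y] lp[OF y x]
        using total_lexord[of "field_order \<alpha>"] by (auto simp: total_on_def)
    qed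
    assume z: "z \<in> carrier_vec n" and "lex_precedes \<alpha> x y" "lex_precedes \<alpha> y z"
    then show "lex_precedes \<alpha> x z"
      unfolding lp[OF x y] lp[OF y z] lp[OF x z]
      using lexord_trans field_order_strict_linear(2) by blast
  qed simp
  then show ?thesis by (simp only: card_carrier_vec)
qed

text \<open>The prefix stops before the element of rank \<lceil>x\<rceil>, hence the - 1. This rank
  exists because r \<le> q gives 0 < x \<le> q^n.\<close>

lemma card_lex_prefix:
  assumes r: "0 < r" "r \<le> CARD('a)" and i: "n \<le> i"
  defines "x \<equiv> real r ^ i / real CARD('a) ^ (i - n)"
  shows "real (card (lex_prefix \<alpha> r n i)) = real_of_int \<lceil>x\<rceil> - 1"
proof -
  define m where "m = nat \<lceil>x\<rceil>"
  have x0: "0 < x" using r by (simp add: x_def)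
  have "x \<le> real CARD('a) ^ i / real CARD('a) ^ (i - n)"
    unfolding x_def using r by (intro divide_right_mono power_mono) auto
  also have "\<dots> = real CARD('a) ^ n"
    using i by (simp add: power_diff)
  finally have "x \<le> real (CARD('a) ^ n)" by simp
  then have "\<lceil>x\<rceil> \<le> int (CARD('a) ^ n)" by (simp add: ceiling_le_iff)
  then have m: "m \<in> {1..CARD('a) ^ n}" using x0 by (auto simp: m_def nat_le_iff le_nat_iff)
  let ?rank = "\<lambda>s. card {x \<in> carrier_vec n. x = s \<or> lex_precedes \<alpha> x s}"
  obtain s where s: "s \<in> carrier_vec n" "?rank s = m"
    using lex_precedes_rank_bij[of n] m by (metis (no_types, lifting) bij_betw_imp_surj_on imageE)
  have "lex_nth \<alpha> n m = s"
    unfolding lex_nth_def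
  proof (rule the_equality)
    fix t assume "t \<in> carrier_vec n \<and> ?rank t = m"
    then show "t = s"
      using s bij_betw_imp_inj_on[OF lex_precedes_rank_bij[of n]] by (auto dest: inj_onD)
  qed (use s in simp)
  then have pre: "lex_prefix \<alpha> r n i = {x \<in> carrier_vec n. lex_precedes \<alpha> x s}"
    by (simp add: lex_prefix_def Let_def m_def x_def)
  have "\<not> lex_precedes \<alpha> s s"
    using field_order_strict_linear(1) lexord_irreflexive[of "field_order \<alpha>" "list_of_vec s"]
    by (auto simp: lex_precedes_def lexord_lex)
  then have "{x \<in> carrier_vec n. x = s \<or> lex_precedes \<alpha> x s} = insert s (lex_prefix \<alpha> r n i)" "s \<notin> lex_prefix \<alpha> r n i"
    using s(1) by (auto simp: pre)
  then have "m = Suc (card (lex_prefix \<alpha> r n i))" using s(2) by (simp add: pre)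
  then show ?thesis using x0 by (simp add: m_def)
qed

end

section \<open>Samples as maxima over affine images\<close>

lemma invertible_mats_iff_det:
  "A \<in> invertible_mats n \<longleftrightarrow> A \<in> carrier_mat n n \<and> det A \<noteq> (0 :: 'a::field)"
proof -
  let ?U = "Units (ring_mat TYPE('a) n ())"
  have U: "A \<in> ?U \<longleftrightarrow> A \<in> invertible_mats n"
    unfolding invertible_mats_iff Units_def ring_mat_def by auto
  show ?thesis
  proof
    assume A: "A \<in> invertible_mats n"
    then have "A \<in> ?U" by (simp only: U)
    from unit_imp_det_non_zero[OF this] show "A \<in> carrier_mat n n \<and> det A \<noteq> 0"
      using invertible_mats_carrier[OF A] by simp
  next
    assume "A \<in> carrier_mat n n \<and> det A \<noteq> 0"
    then have "A \<in> ?U" by (intro det_non_zero_imp_unit) auto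
    then show "A \<in> invertible_mats n" by (simp only: U)
  qed
qed

text \<open>A uniform ordered basis thus becomes a uniform invertible matrix, so both ranges of
  levels use the same random affine map. Both directions go through the column rank.\<close>

lemma ordered_bases_bij_betw:
  "bij_betw (mat_of_cols n) (ordered_bases n) (invertible_mats n :: 'a::field mat set)"
proof -
  interpret vec_space "TYPE('a)" n .
  have ob: "es \<in> ordered_bases n \<longleftrightarrow> distinct es \<and> basis (set es)" for es :: "'a Matrix.vec list"
    by (simp add: ordered_bases_def)
  have sub: "set es \<subseteq> carrier_vec n" if "es \<in> ordered_bases n" for es :: "'a Matrix.vec list"
    using that by (auto simp: ob basis_def)
  show ?thesis
  proof (rule bij_betwI[of _ _ _ cols])
    show "mat_of_cols n \<in> ordered_bases n \<rightarrow> (invertible_mats n :: 'a mat set)"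
    proof
      fix es :: "'a Matrix.vec list" assume es: "es \<in> ordered_bases n"
      have len: "length es = n"
        using es dim_basis[of "set es"] distinct_card[of es] dim_is_n by (simp add: ob)
      have c: "mat_of_cols n es \<in> carrier_mat n n" using len mat_of_cols_carrier(1)[of n es] by simp
      have "rank (mat_of_cols n es) = n"
        using es c sub[OF es] by (intro lin_indpt_full_rank) (auto simp: ob basis_def)
      then show "mat_of_cols n es \<in> invertible_mats n"
        using c det_rank_iff[OF c] by (simp add: invertible_mats_iff_det)
    qed
    show "cols \<in> invertible_mats n \<rightarrow> (ordered_bases n :: 'a Matrix.vec list set)"
    proof
      fix A :: "'a mat" assume "A \<in> invertible_mats n"
      then have A: "A \<in> carrier_mat n n" and rk: "rank A = n"
        using det_rank_iff[of A] by (auto simp: invertible_mats_iff_det)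
      have d: "distinct (cols A)" using non_distinct_low_rank[OF A] rk by auto
      have li: "lin_indpt (set (cols A))" using full_rank_lin_indpt[OF A rk d] .
      have "basis (set (cols A))"
        using A d li cols_dim[of A] by (intro dim_li_is_basis) (auto simp: distinct_card dim_is_n)
      then show "cols A \<in> ordered_bases n" using d by (simp add: ob)
    qed
  qed (use sub in \<open>auto simp: invertible_mats_def\<close>)
qed

lemma mat_of_cols_append_mult_vec:
  assumes "x \<in> carrier_vec (length es)" "y \<in> carrier_vec (length fs)"
  shows "mat_of_cols n (es @ fs) *\<^sub>v (x @\<^sub>v y) = mat_of_cols n es *\<^sub>v x + mat_of_cols n fs *\<^sub>v (y :: 'a::field Matrix.vec)"
proof (rule eq_vecI)
  fix i assume "i < dim_vec (mat_of_cols n es *\<^sub>v x + mat_of_cols n fs *\<^sub>v y)"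
  then have i: "i < n" by simp
  have "row (mat_of_cols n (es @ fs)) i = row (mat_of_cols n es) i @\<^sub>v row (mat_of_cols n fs) i"
    using i by (intro eq_vecI) (auto simp: mat_of_cols_index nth_append)
  moreover have "(row (mat_of_cols n es) i @\<^sub>v row (mat_of_cols n fs) i) \<bullet> (x @\<^sub>v y) =
      row (mat_of_cols n es) i \<bullet> x + row (mat_of_cols n fs) i \<bullet> y"
    using assms by (intro scalar_prod_append[of _ "length es" _ "length fs"]) (auto intro: carrier_vecI)
  ultimately show "(mat_of_cols n (es @ fs) *\<^sub>v (x @\<^sub>v y)) $ i = (mat_of_cols n es *\<^sub>v x + mat_of_cols n fs *\<^sub>v y) $ i"
    using i by simp
qed simp

text \<open>The fixed set whose random affine image is searched at level \<open>i\<close>. For i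
  \<le> n, A x + R y is the whole basis matrix applied to the concatenation of x and y, so the last
  \<open>i\<close> coordinates are confined to \<open>r\<close> field elements.\<close>

definition sample_domain :: "(nat \<Rightarrow> 'a::{field,finite}) \<Rightarrow> nat \<Rightarrow> nat \<Rightarrow> nat \<Rightarrow> 'a Matrix.vec set" where
  "sample_domain \<alpha> r n i = (if i \<le> n
     then (\<lambda>(x, y). x @\<^sub>v y) ` (carrier_vec (n - i) \<times> {y \<in> carrier_vec i. set\<^sub>v y \<subseteq> \<alpha> ` {..<r}})
     else lex_prefix \<alpha> r n i)"

lemma sample_domain_subset: "sample_domain \<alpha> r n i \<subseteq> carrier_vec n"
proof (cases "i \<le> n")
  case True
  have "x @\<^sub>v y \<in> carrier_vec n" if "x \<in> carrier_vec (n - i)" "y \<in> carrier_vec i" for x y :: "'a Matrix.vec"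
    using append_carrier_vec[OF that] True by simp
  then show ?thesis using True by (auto simp: sample_domain_def)
qed (auto simp: sample_domain_def lex_prefix_def Let_def)

lemma card_vec_entries:
  fixes S :: "'a::finite set"
  shows "card {y \<in> carrier_vec i. set\<^sub>v y \<subseteq> S} = card S ^ i"
proof -
  have "bij_betw list_of_vec {y \<in> carrier_vec i. set\<^sub>v y \<subseteq> S} {xs. set xs \<subseteq> S \<and> length xs = i}"
  proof (rule bij_betw_subset[OF bij_betw_list_of_vec[of i]])
    show "list_of_vec ` {y \<in> carrier_vec i. set\<^sub>v y \<subseteq> S} = {xs. set xs \<subseteq> S \<and> length xs = i}"
      using bij_betw_imp_surj_on[OF bij_betw_list_of_vec[of i, where ?'a='a]] by (auto simp: set_list_of_vec[symmetric] image_iff)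
  qed auto
  then show ?thesis by (simp add: bij_betw_same_card card_lists_length_eq)
qed

text \<open>For i \<le> n the size q^(n - i) r^i equals q^n / \<kappa>^i. For larger
  \<open>i\<close> the prefix has \<lceil>q^n / \<kappa>^i\<rceil> - 1 elements, at most one too
  few; it may be empty.\<close>

lemma sample_domain_card:
  fixes \<alpha> :: "nat \<Rightarrow> 'a::{field,finite}"
  assumes bij: "bij_betw \<alpha> {..<CARD('a)} UNIV" and r: "0 < r" "r < CARD('a)"
  defines "\<kappa> \<equiv> real CARD('a) / real r"
  shows "real (card (sample_domain \<alpha> r n i)) \<le> real CARD('a) ^ n / \<kappa> ^ i"
    and "real CARD('a) ^ n / \<kappa> ^ i \<le> real (card (sample_domain \<alpha> r n i)) + 1"
proof -
  define q where "q = real CARD('a)"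
  have q0: "q > 0" by (simp add: q_def)
  have "real (card (sample_domain \<alpha> r n i)) \<le> q ^ n / \<kappa> ^ i \<and> q ^ n / \<kappa> ^ i \<le> real (card (sample_domain \<alpha> r n i)) + 1"
  proof (cases "i \<le> n")
    case True
    have inj: "inj_on (\<lambda>(x, y). x @\<^sub>v y) (carrier_vec (n - i) \<times> {y \<in> carrier_vec i. set\<^sub>v y \<subseteq> \<alpha> ` {..<r}})"
      by (auto simp: inj_on_def append_vec_eq[of _ "n - i"])
    have "inj_on \<alpha> {..<r}"
      by (rule inj_on_subset[OF bij_betw_imp_inj_on[OF bij]]) (use r in auto)
    then have cr: "card (\<alpha> ` {..<r}) = r" by (simp add: card_image)
    have "card (sample_domain \<alpha> r n i) = CARD('a) ^ (n - i) * r ^ i"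
      using True by (simp add: sample_domain_def card_image[OF inj] card_cartesian_product card_carrier_vec card_vec_entries cr)
    then have "real (card (sample_domain \<alpha> r n i)) = q ^ (n - i) * real r ^ i" by (simp add: q_def)
    also have "\<dots> = q ^ n / \<kappa> ^ i"
      using True q0 r by (simp add: \<kappa>_def q_def power_diff power_divide)
    finally show ?thesis by simp
  next
    case False
    have "real (card (sample_domain \<alpha> r n i)) = real_of_int \<lceil>real r ^ i / real CARD('a) ^ (i - n)\<rceil> - 1"
      using False card_lex_prefix[OF bij, of r n i] r by (simp add: sample_domain_def)
    also have "real r ^ i / real CARD('a) ^ (i - n) = q ^ n / \<kappa> ^ i"
      using False q0 r by (simp add: \<kappa>_def q_def power_diff power_divide)
    finally show ?thesis by linarith
  qed
  then show "real (card (sample_domain \<alpha> r n i)) \<le> real CARD('a) ^ n / \<kappa> ^ i"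
    "real CARD('a) ^ n / \<kappa> ^ i \<le> real (card (sample_domain \<alpha> r n i)) + 1" by (auto simp: q_def)
qed

definition max_over :: "('b \<Rightarrow> real) \<Rightarrow> 'b set \<Rightarrow> real" where
  "max_over w X = (if X = {} then 0 else Max (w ` X))"

lemma pair_pmf_of_set:
  assumes "finite A" "A \<noteq> {}" "finite B" "B \<noteq> {}"
  shows "pair_pmf (pmf_of_set A) (pmf_of_set B) = pmf_of_set (A \<times> B)"
proof (rule pmf_eqI)
  fix p :: "'a \<times> 'b"
  show "pmf (pair_pmf (pmf_of_set A) (pmf_of_set B)) p = pmf (pmf_of_set (A \<times> B)) p"
    using assms by (cases p) (auto simp: pmf_pair card_cartesian_product indicator_def)
qed

lemma mb_wish_sample_eq:
  fixes \<alpha> :: "nat \<Rightarrow> 'a::{field,finite}"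
  shows "mb_wish_sample \<alpha> r n w i =
    map_pmf (\<lambda>(A, b). (max_over w ((\<lambda>y. A *\<^sub>v y + b) ` sample_domain \<alpha> r n i), 1))
      (pmf_of_set (invertible_mats n \<times> carrier_vec n))"
proof -
  let ?GL = "invertible_mats n :: 'a mat set" and ?V = "carrier_vec n :: 'a Matrix.vec set"
  let ?D = "sample_domain \<alpha> r n i"
  let ?g = "\<lambda>A b. max_oracle w ((\<lambda>y. A *\<^sub>v y + b) ` ?D)"
  have ne: "?GL \<noteq> {}" "?V \<noteq> {}" using one_invertible_mats zero_carrier_vec by blast+
  have "mb_wish_sample \<alpha> r n w i = do {A \<leftarrow> pmf_of_set ?GL; b \<leftarrow> pmf_of_set ?V; ?g A b}"
  proof (cases "i \<le> n")
    case True
    have fin: "finite (ordered_bases n :: 'a Matrix.vec list set)" "ordered_bases n \<noteq> ({} :: 'a Matrix.vec list set)"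
      using bij_betw_finite[OF ordered_bases_bij_betw[of n, where ?'a='a]] finite_invertible_mats[of n, where ?'a='a]
        ordered_bases_bij_betw[of n, where ?'a='a] ne by (auto simp: bij_betw_def)
    have "mb_wish_sample \<alpha> r n w i = do {es \<leftarrow> pmf_of_set (ordered_bases n); b \<leftarrow> pmf_of_set ?V; ?g (mat_of_cols n es) b}"
      unfolding mb_wish_sample_def using True
    proof (simp, intro bind_pmf_cong refl)
      fix es :: "'a Matrix.vec list" and b :: "'a Matrix.vec" assume "es \<in> set_pmf (pmf_of_set (ordered_bases n))"
      then have "mat_of_cols n es \<in> invertible_mats n"
        using fin bij_betwE[OF ordered_bases_bij_betw[of n]] by auto
      then have len: "length es = n" using invertible_mats_carrier by fastforce
      have split: "mat_of_cols n es *\<^sub>v (x @\<^sub>v y) = mat_of_cols n (take (n - i) es) *\<^sub>v x + mat_of_cols n (drop (n - i) es) *\<^sub>v y"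
        if "x \<in> carrier_vec (n - i)" "y \<in> carrier_vec i" for x y
        using mat_of_cols_append_mult_vec[of x "take (n - i) es" y "drop (n - i) es" n] that len True by simp
      have "{mat_of_cols n (take (n - i) es) *\<^sub>v x + mat_of_cols n (drop (n - i) es) *\<^sub>v y + b | x y.
          x \<in> carrier_vec (n - i) \<and> y \<in> carrier_vec i \<and> set\<^sub>v y \<subseteq> \<alpha> ` {..<r}} =
          {mat_of_cols n es *\<^sub>v (x @\<^sub>v y) + b | x y.
          x \<in> carrier_vec (n - i) \<and> y \<in> carrier_vec i \<and> set\<^sub>v y \<subseteq> \<alpha> ` {..<r}}"
        using split by (intro Collect_cong ex_cong1) auto
      also have "\<dots> = (\<lambda>y. mat_of_cols n es *\<^sub>v y + b) ` ?D"
        using True by (auto simp: sample_domain_def)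
      finally show "max_oracle w {mat_of_cols n (take (n - i) es) *\<^sub>v x + mat_of_cols n (drop (n - i) es) *\<^sub>v y + b | x y.
          x \<in> carrier_vec (n - i) \<and> y \<in> carrier_vec i \<and> set\<^sub>v y \<subseteq> \<alpha> ` {..<r}} = ?g (mat_of_cols n es) b" by simp
    qed
    also have "\<dots> = do {A \<leftarrow> map_pmf (mat_of_cols n) (pmf_of_set (ordered_bases n)); b \<leftarrow> pmf_of_set ?V; ?g A b}"
      by (simp add: bind_map_pmf)
    also have "map_pmf (mat_of_cols n) (pmf_of_set (ordered_bases n)) = pmf_of_set ?GL"
      by (rule map_pmf_of_set_bij_betw[OF ordered_bases_bij_betw fin(2,1)])
    finally show ?thesis .
  next
    case False
    then show ?thesis
      by (simp add: mb_wish_sample_def invertible_mats_def sample_domain_def setcompr_eq_image)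
  qed
  also have "\<dots> = map_pmf (\<lambda>(A, b). (max_over w ((\<lambda>y. A *\<^sub>v y + b) ` ?D), 1)) (pair_pmf (pmf_of_set ?GL) (pmf_of_set ?V))"
    by (simp add: pair_pmf_def map_pmf_def bind_assoc_pmf bind_return_pmf max_oracle_def max_over_def)
  also have "pair_pmf (pmf_of_set ?GL) (pmf_of_set ?V) = pmf_of_set (?GL \<times> ?V)"
    using ne by (intro pair_pmf_of_set finite_invertible_mats) auto
  finally show ?thesis .
qed

text \<open>The sequence to which the block estimates are applied; rank 0 is the maximum. For
  nonnegative \<open>w\<close> the padding by 0 keeps it decreasing, and it agrees with the oracle's
  answer on an empty set.\<close>

definition ranked_value :: "('b \<Rightarrow> real) \<Rightarrow> (nat \<Rightarrow> 'b) \<Rightarrow> nat \<Rightarrow> nat \<Rightarrow> real" where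
  "ranked_value w f N j = (if j < N then w (f j) else 0)"

section \<open>Quantile bounds for a single sample\<close>

context
  fixes \<alpha> :: "nat \<Rightarrow> 'a::{field,finite}" and n r :: nat and w :: "'a Matrix.vec \<Rightarrow> real"
    and f :: "nat \<Rightarrow> 'a Matrix.vec" and N :: nat
  assumes n: "n \<ge> 1" and nonneg: "\<And>\<sigma>. \<sigma> \<in> carrier_vec n \<Longrightarrow> 0 \<le> w \<sigma>"
    and N: "N = CARD('a) ^ n"
    and enum: "bij_betw f {..<N} (carrier_vec n)"
    and decr: "\<And>i j. i \<le> j \<Longrightarrow> j < N \<Longrightarrow> w (f j) \<le> w (f i)"
begin

interpretation pairwise_uniform "invertible_mats n \<times> carrier_vec n" "carrier_vec n"
  "\<lambda>(A, b) y. A *\<^sub>v y + b :: 'a Matrix.vec"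
  by (rule pairwise_uniform_affine[OF n])

lemma enum_carrier: "j < N \<Longrightarrow> f j \<in> carrier_vec n"
  using enum by (auto simp: bij_betw_def)

lemma card_enum_image: "g \<le> N \<Longrightarrow> card (f ` {..<g}) = g"
  using inj_on_subset[OF bij_betw_imp_inj_on[OF enum], of "{..<g}"] by (simp add: card_image)

lemma prob_sample:
  "measure_pmf.prob (mb_wish_sample \<alpha> r n w i) {(x, c). P x} =
    real (card {(A, b) \<in> invertible_mats n \<times> carrier_vec n.
      P (max_over w ((\<lambda>y. A *\<^sub>v y + b) ` sample_domain \<alpha> r n i))})
    / real (card (invertible_mats n \<times> carrier_vec n :: ('a mat \<times> 'a Matrix.vec) set))"
  unfolding mb_wish_sample_eq measure_map_pmf
  by (subst measure_pmf_of_set[OF space_nonempty finite_space])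
    (auto intro!: arg_cong[of _ _ card] simp: vimage_def)

lemma max_over_mem:
  assumes "finite X" "X \<noteq> {}"
  obtains x where "x \<in> X" "max_over w X = w x"
proof -
  have "max_over w X \<in> w ` X" using Max_in[of "w ` X"] assms by (simp add: max_over_def)
  then show ?thesis using that by auto
qed

lemma max_over_ge: "finite X \<Longrightarrow> x \<in> X \<Longrightarrow> w x \<le> max_over w X"
  by (auto simp: max_over_def intro!: Max_ge)

lemma affine_image_subset:
  assumes "A \<in> invertible_mats n" "b \<in> carrier_vec n"
  shows "(\<lambda>y. A *\<^sub>v y + b) ` sample_domain \<alpha> r n i \<subseteq> carrier_vec n"
  using maps[of "(A, b)"] assms sample_domain_subset[of \<alpha> r n i] by auto

text \<open>A maximum below the g-th largest value, which has index g - 1, means that the image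
  misses all points carrying the g largest values.\<close>

lemma prob_sample_less:
  assumes g: "1 \<le> g" "g \<le> N" and \<kappa>: "2 \<le> \<kappa>"
    and large: "\<kappa> * real N \<le> (real (card (sample_domain \<alpha> r n i)) + 1) * real g"
  shows "measure_pmf.prob (mb_wish_sample \<alpha> r n w i) {(x, c). x < ranked_value w f N (g - 1)} \<le> 1 / (1 + \<kappa>)"
proof -
  let ?\<Omega> = "invertible_mats n \<times> carrier_vec n :: ('a mat \<times> 'a Matrix.vec) set"
  let ?D = "sample_domain \<alpha> r n i" and ?G = "f ` {..<g}"
  have G: "?G \<subseteq> carrier_vec n" using g enum_carrier by auto
  have "{(A, b) \<in> ?\<Omega>. max_over w ((\<lambda>y. A *\<^sub>v y + b) ` ?D) < ranked_value w f N (g - 1)} \<subseteq>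
      {\<omega> \<in> ?\<Omega>. (case \<omega> of (A, b) \<Rightarrow> \<lambda>y. A *\<^sub>v y + b) ` ?D \<inter> ?G = {}}"
  proof safe
    fix A b x j assume AB: "A \<in> invertible_mats n" "b \<in> carrier_vec n"
      and less: "max_over w ((\<lambda>y. A *\<^sub>v y + b) ` ?D) < ranked_value w f N (g - 1)"
      and j: "x \<in> ?D" "j < g" "A *\<^sub>v x + b = f j"
    have "w (f j) \<le> max_over w ((\<lambda>y. A *\<^sub>v y + b) ` ?D)"
      using j(1) j(3)[symmetric] finite_subset[OF affine_image_subset[OF AB] finite_points] by (intro max_over_ge) auto
    moreover have "ranked_value w f N (g - 1) \<le> w (f j)"
      using j g decr[of j "g - 1"] by (auto simp: ranked_value_def)
    ultimately show "A *\<^sub>v x + b \<in> {}" using less by simp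
  qed
  then have "real (card {(A, b) \<in> ?\<Omega>. max_over w ((\<lambda>y. A *\<^sub>v y + b) ` ?D) < ranked_value w f N (g - 1)}) \<le>
      real (card {\<omega> \<in> ?\<Omega>. (case \<omega> of (A, b) \<Rightarrow> \<lambda>y. A *\<^sub>v y + b) ` ?D \<inter> ?G = {}})"
    using finite_space by (intro of_nat_mono card_mono) auto
  also have "\<dots> \<le> real (card ?\<Omega>) / (1 + \<kappa>)"
    using large g by (intro card_miss_le[OF sample_domain_subset G \<kappa>]) (simp add: card_carrier_vec N card_enum_image)
  finally show ?thesis
    unfolding prob_sample using finite_space space_nonempty \<kappa> by (simp add: divide_simps card_gt_0_iff mult.commute)
qed

text \<open>A maximum above the value of index g is attained at one of the first g points. It cannot
  come from an empty image, since the oracle then answers 0 and ranked values are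
  nonnegative.\<close>

lemma prob_sample_greater:
  assumes small: "real (card (sample_domain \<alpha> r n i)) * real g \<le> \<beta> * real N"
  shows "measure_pmf.prob (mb_wish_sample \<alpha> r n w i) {(x, c). ranked_value w f N g < x} \<le> \<beta>"
proof -
  let ?\<Omega> = "invertible_mats n \<times> carrier_vec n :: ('a mat \<times> 'a Matrix.vec) set"
  let ?D = "sample_domain \<alpha> r n i" and ?G = "f ` {..<min g N}"
  have N0: "N > 0" by (simp add: N)
  have G: "?G \<subseteq> carrier_vec n" using enum_carrier by auto
  have "{(A, b) \<in> ?\<Omega>. ranked_value w f N g < max_over w ((\<lambda>y. A *\<^sub>v y + b) ` ?D)} \<subseteq>
      {\<omega> \<in> ?\<Omega>. (case \<omega> of (A, b) \<Rightarrow> \<lambda>y. A *\<^sub>v y + b) ` ?D \<inter> ?G \<noteq> {}}"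
  proof
    fix \<omega> assume "\<omega> \<in> {(A, b) \<in> ?\<Omega>. ranked_value w f N g < max_over w ((\<lambda>y. A *\<^sub>v y + b) ` ?D)}"
    then obtain A b where \<omega>: "\<omega> = (A, b)" and AB: "A \<in> invertible_mats n" "b \<in> carrier_vec n"
      and less: "ranked_value w f N g < max_over w ((\<lambda>y. A *\<^sub>v y + b) ` ?D)" by auto
    have rv: "0 \<le> ranked_value w f N g" using nonneg enum_carrier by (auto simp: ranked_value_def)
    let ?X = "(\<lambda>y. A *\<^sub>v y + b) ` ?D"
    have X: "?X \<subseteq> carrier_vec n" by (rule affine_image_subset[OF AB])
    have "?X \<noteq> {}" using less rv by (auto simp: max_over_def)
    then obtain x where x: "x \<in> ?X" "max_over w ?X = w x"
      using max_over_mem finite_subset[OF X finite_points] by blast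
    have "x \<in> f ` {..<N}" using X x enum by (auto simp: bij_betw_def)
    then obtain j where j: "j < N" "x = f j" by auto
    have "j < g"
    proof (rule ccontr)
      assume "\<not> j < g"
      then have "w x \<le> ranked_value w f N g" using j decr[of g j] by (auto simp: ranked_value_def)
      then show False using less x by simp
    qed
    then have "x \<in> ?G" using j by simp
    then show "\<omega> \<in> {\<omega> \<in> ?\<Omega>. (case \<omega> of (A, b) \<Rightarrow> \<lambda>y. A *\<^sub>v y + b) ` ?D \<inter> ?G \<noteq> {}}"
      using AB x(1) by (auto simp: \<omega>)
  qed
  then have "real (card {(A, b) \<in> ?\<Omega>. ranked_value w f N g < max_over w ((\<lambda>y. A *\<^sub>v y + b) ` ?D)}) \<le>
      real (card {\<omega> \<in> ?\<Omega>. (case \<omega> of (A, b) \<Rightarrow> \<lambda>y. A *\<^sub>v y + b) ` ?D \<inter> ?G \<noteq> {}})"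
    using finite_space by (intro of_nat_mono card_mono) auto
  also have "\<dots> \<le> real (card ?D) * real (min g N) * real (card ?\<Omega>) / real N"
    using card_hit_le[OF sample_domain_subset G] by (simp add: card_carrier_vec N card_enum_image)
  also have "\<dots> \<le> \<beta> * real (card ?\<Omega>)"
  proof -
    have "real (card ?D) * real (min g N) \<le> real (card ?D) * real g" by (intro mult_left_mono) auto
    also have "\<dots> \<le> \<beta> * real N" by (rule small)
    finally have "real (card ?D) * real (min g N) * real (card ?\<Omega>) \<le> \<beta> * real N * real (card ?\<Omega>)"
      by (intro mult_right_mono) auto
    then show ?thesis using N0 by (simp add: pos_divide_le_eq mult_ac)
  qed
  finally show ?thesis
    unfolding prob_sample using finite_space space_nonempty by (simp add: pos_divide_le_eq card_gt_0_iff)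
qed

lemma sample_nonneg: "(x, c) \<in> set_pmf (mb_wish_sample \<alpha> r n w i) \<Longrightarrow> 0 \<le> x"
proof -
  assume "(x, c) \<in> set_pmf (mb_wish_sample \<alpha> r n w i)"
  then obtain A b where AB: "A \<in> invertible_mats n" "b \<in> carrier_vec n"
    and x: "x = max_over w ((\<lambda>y. A *\<^sub>v y + b) ` sample_domain \<alpha> r n i)" (is "_ = max_over w ?X")
    unfolding mb_wish_sample_eq using space_nonempty finite_space by auto
  have X: "?X \<subseteq> carrier_vec n" by (rule affine_image_subset[OF AB])
  show "0 \<le> x"
  proof (cases "?X = {}")
    case False
    then obtain y where "y \<in> ?X" "max_over w ?X = w y"
      using max_over_mem finite_subset[OF X finite_points] by blast
    then show ?thesis unfolding x using X nonneg by auto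
  qed (simp add: x max_over_def)
qed

section \<open>Error probabilities of levels and of the estimate\<close>

context
  fixes \<kappa> :: real
  assumes bij: "bij_betw \<alpha> {..<CARD('a)} UNIV" and r: "0 < r" and \<kappa>: "\<kappa> = real CARD('a) / real r" "2 \<le> \<kappa>"
begin

lemma r_less: "r < CARD('a)"
proof -
  have "real r < 2 * real r" using r by simp
  also have "\<dots> \<le> \<kappa> * real r" using \<kappa>(2) by (intro mult_right_mono) auto
  also have "\<dots> = real CARD('a)" using r \<kappa>(1) by simp
  finally show ?thesis by simp
qed

text \<open>About N / \<kappa>^(i + 1) arguments against the \<kappa>^(i + 2) best points give about
  \<kappa> expected hits, as the second moment bound requires. If there are fewer than that many
  points, the threshold is the padding value 0 and no sample lies below it.\<close>

lemma prob_sample_low: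
  "measure_pmf.prob (mb_wish_sample \<alpha> r n w (Suc i))
    {(x, c). x < ranked_value w f N (nat \<lceil>\<kappa> ^ (i + 2)\<rceil> - 1)} \<le> 1 / (1 + \<kappa>)"
proof (cases "nat \<lceil>\<kappa> ^ (i + 2)\<rceil> \<le> N")
  case True
  let ?D = "sample_domain \<alpha> r n (Suc i)"
  have pos: "0 < \<kappa> ^ j" for j using \<kappa> by simp
  have g: "1 \<le> nat \<lceil>\<kappa> ^ (i + 2)\<rceil>" using pos[of "i + 2"] by linarith
  have "real N / \<kappa> ^ Suc i \<le> real (card ?D) + 1"
    using sample_domain_card(2)[OF bij r r_less, of n "Suc i"] \<kappa> by (simp add: N)
  then have "real N / \<kappa> ^ Suc i * \<kappa> ^ (i + 2) \<le> (real (card ?D) + 1) * real (nat \<lceil>\<kappa> ^ (i + 2)\<rceil>)"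
    using pos[of "i + 2"] by (intro mult_mono) (auto simp: less_imp_le)
  moreover have "real N / \<kappa> ^ Suc i * \<kappa> ^ (i + 2) = \<kappa> * real N" using \<kappa> by simp
  ultimately show ?thesis by (intro prob_sample_less[OF g True \<kappa>(2)]) simp
next
  case False
  then have "\<not> nat \<lceil>\<kappa> ^ (i + 2)\<rceil> - 1 < N" by linarith
  then have "ranked_value w f N (nat \<lceil>\<kappa> ^ (i + 2)\<rceil> - 1) = 0" by (simp only: ranked_value_def if_False)
  then have "set_pmf (mb_wish_sample \<alpha> r n w (Suc i)) \<inter>
      {(x, c). x < ranked_value w f N (nat \<lceil>\<kappa> ^ (i + 2)\<rceil> - 1)} = {}"
    using sample_nonneg by fastforce
  then have "measure_pmf.prob (mb_wish_sample \<alpha> r n w (Suc i))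
    {(x, c). x < ranked_value w f N (nat \<lceil>\<kappa> ^ (i + 2)\<rceil> - 1)} = 0" by (simp only: measure_pmf_zero_iff)
  then show ?thesis using \<kappa>(2) by simp
qed

text \<open>At most \<kappa>^(-2) hits of the \<kappa>^(i - 1) best points are expected. For i = 0
  the threshold is the maximum of \<open>w\<close> itself and the set of better points is
  empty.\<close>

lemma prob_sample_high:
  "measure_pmf.prob (mb_wish_sample \<alpha> r n w (Suc i))
    {(x, c). ranked_value w f N (if i = 0 then 0 else nat \<lfloor>\<kappa> ^ (i - 1)\<rfloor>) < x} \<le> 1 / (1 + \<kappa>)"
proof (rule prob_sample_greater)
  let ?D = "sample_domain \<alpha> r n (Suc i)"
  show "real (card ?D) * real (if i = 0 then 0 else nat \<lfloor>\<kappa> ^ (i - 1)\<rfloor>) \<le> 1 / (1 + \<kappa>) * real N"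
  proof (cases "i = 0")
    case False
    then obtain j where [simp]: "i = Suc j" by (cases i) auto
    have pos: "0 < \<kappa> ^ j" for j using \<kappa> by simp
    have "real (card ?D) \<le> real N / \<kappa> ^ Suc i"
      using sample_domain_card(1)[OF bij r r_less, of n "Suc i"] \<kappa> by (simp add: N)
    moreover have "real (nat \<lfloor>\<kappa> ^ j\<rfloor>) \<le> \<kappa> ^ j" using pos[of j] by (simp add: less_imp_le)
    ultimately have "real (card ?D) * real (nat \<lfloor>\<kappa> ^ j\<rfloor>) \<le> real N / \<kappa> ^ Suc i * \<kappa> ^ j"
      using pos by (intro mult_mono) (auto simp: less_imp_le)
    also have "\<dots> = real N / \<kappa>\<^sup>2" using \<kappa> by (simp add: power2_eq_square)
    also have "\<dots> \<le> real N / (1 + \<kappa>)"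
    proof -
      have "1 + \<kappa> \<le> 2 * \<kappa>" using \<kappa> by simp
      also have "\<dots> \<le> \<kappa> * \<kappa>" using \<kappa>(2) by (intro mult_right_mono) auto
      finally show ?thesis using \<kappa>(2) by (intro divide_left_mono) (auto simp: power2_eq_square)
    qed
    finally show ?thesis by simp
  qed (use \<kappa>(2) in simp)
qed

lemma prob_level:
  assumes "l \<ge> 1"
  shows "measure_pmf.prob (mb_wish_level \<alpha> r n w l (Suc i))
    {(x, c). \<not> (ranked_value w f N (nat \<lceil>\<kappa> ^ (i + 2)\<rceil> - 1) \<le> x \<and>
      x \<le> ranked_value w f N (if i = 0 then 0 else nat \<lfloor>\<kappa> ^ (i - 1)\<rfloor>))} \<le> 2 * (2 * sqrt \<kappa> / (1 + \<kappa>)) ^ l"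
  using prob_level_bad_le[OF prob_sample_low prob_sample_high _ assms] \<kappa>(2) by simp

lemma prob_estimate:
  assumes l: "l \<ge> 1" and m: "real N \<le> \<kappa> ^ m"
  shows "measure_pmf.prob (run_all (map (mb_wish_level \<alpha> r n w l) [1..<Suc m]))
    {(Ms, d). \<not> ((\<Sum>\<sigma>\<in>carrier_vec n. w \<sigma>) / \<kappa>\<^sup>2 \<le> max_over w (carrier_vec n) + (\<kappa> - 1) * (\<Sum>i<m. Ms ! i * \<kappa> ^ i) \<and>
       max_over w (carrier_vec n) + (\<kappa> - 1) * (\<Sum>i<m. Ms ! i * \<kappa> ^ i) \<le> \<kappa>\<^sup>2 * (\<Sum>\<sigma>\<in>carrier_vec n. w \<sigma>))}
    \<le> real m * (2 * (2 * sqrt \<kappa> / (1 + \<kappa>)) ^ l)"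
proof -
  let ?a = "ranked_value w f N"
  let ?ps = "map (mb_wish_level \<alpha> r n w l) [1..<Suc m]"
  let ?good = "\<lambda>i x. ?a (nat \<lceil>\<kappa> ^ (i + 2)\<rceil> - 1) \<le> x \<and> x \<le> ?a (if i = 0 then 0 else nat \<lfloor>\<kappa> ^ (i - 1)\<rfloor>)"
  have N0: "N > 0" by (simp add: N)
  interpret decreasing_values ?a N \<kappa>
  proof
    show "antimono ?a"
      using decr nonneg enum_carrier by (auto intro!: antimonoI simp: ranked_value_def)
    show "0 \<le> ?a j" for j using nonneg enum_carrier by (auto simp: ranked_value_def)
  qed (use N0 \<kappa>(2) in \<open>auto simp: ranked_value_def\<close>)
  have S: "(\<Sum>\<sigma>\<in>carrier_vec n. w \<sigma>) = (\<Sum>j<N. ?a j)"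
    using sum.reindex_bij_betw[OF enum, of w] by (simp add: ranked_value_def)
  have top: "max_over w (carrier_vec n) = ?a 0"
  proof -
    have "Max (w ` carrier_vec n) = w (f 0)"
    proof (rule Max_eqI)
      fix y assume "y \<in> w ` carrier_vec n"
      then have "y \<in> w ` f ` {..<N}" using enum by (simp add: bij_betw_def)
      then obtain j where "j < N" "y = w (f j)" by auto
      then show "y \<le> w (f 0)" using decr[of 0 j] by simp
    qed (use enum_carrier N0 in auto)
    then show ?thesis using N0 enum_carrier[OF N0] by (auto simp: max_over_def ranked_value_def)
  qed
  have "measure_pmf.prob (run_all ?ps) {(Ms, d). \<not> (\<forall>i<length ?ps. ?good i (Ms ! i))} \<le>
      real (length ?ps) * (2 * (2 * sqrt \<kappa> / (1 + \<kappa>)) ^ l)"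
  proof (rule prob_run_all_bad_le)
    fix i assume "i < length ?ps"
    then have "?ps ! i = mb_wish_level \<alpha> r n w l (Suc i)" by (simp del: upt_Suc)
    then show "measure_pmf.prob (?ps ! i) {(x, c). \<not> ?good i x} \<le> 2 * (2 * sqrt \<kappa> / (1 + \<kappa>)) ^ l"
      using prob_level[OF l, of i] by simp
  qed
  moreover have "length ?ps = m" by simp
  ultimately have "measure_pmf.prob (run_all ?ps) {(Ms, d). \<not> (\<forall>i<m. ?good i (Ms ! i))} \<le>
      real m * (2 * (2 * sqrt \<kappa> / (1 + \<kappa>)) ^ l)" by (simp only:)
  moreover have "measure_pmf.prob (run_all ?ps)
     {(Ms, d). \<not> ((\<Sum>\<sigma>\<in>carrier_vec n. w \<sigma>) / \<kappa>\<^sup>2 \<le> max_over w (carrier_vec n) + (\<kappa> - 1) * (\<Sum>i<m. Ms ! i * \<kappa> ^ i) \<and>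
       max_over w (carrier_vec n) + (\<kappa> - 1) * (\<Sum>i<m. Ms ! i * \<kappa> ^ i) \<le> \<kappa>\<^sup>2 * (\<Sum>\<sigma>\<in>carrier_vec n. w \<sigma>))}
    \<le> measure_pmf.prob (run_all ?ps) {(Ms, d). \<not> (\<forall>i<m. ?good i (Ms ! i))}"
  proof (rule measure_pmf.finite_measure_mono)
    have "(\<Sum>j<N. ?a j) / \<kappa>\<^sup>2 \<le> ?a 0 + (\<kappa> - 1) * (\<Sum>i<m. Ms ! i * \<kappa> ^ i) \<and>
       ?a 0 + (\<kappa> - 1) * (\<Sum>i<m. Ms ! i * \<kappa> ^ i) \<le> \<kappa>\<^sup>2 * (\<Sum>j<N. ?a j)"
      if "\<forall>i<m. ?good i (Ms ! i)" for Ms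
      using estimate_lower[OF m, of "\<lambda>i. Ms ! i"] estimate_upper[of m "\<lambda>i. Ms ! i"] that by blast
    then show "{(Ms, d). \<not> ((\<Sum>\<sigma>\<in>carrier_vec n. w \<sigma>) / \<kappa>\<^sup>2 \<le> max_over w (carrier_vec n) + (\<kappa> - 1) * (\<Sum>i<m. Ms ! i * \<kappa> ^ i) \<and>
       max_over w (carrier_vec n) + (\<kappa> - 1) * (\<Sum>i<m. Ms ! i * \<kappa> ^ i) \<le> \<kappa>\<^sup>2 * (\<Sum>\<sigma>\<in>carrier_vec n. w \<sigma>))}
      \<subseteq> {(Ms, d). \<not> (\<forall>i<m. ?good i (Ms ! i))}"
      unfolding S top by blast
  qed simp
  ultimately show ?thesis by linarith
qed

end
end

section \<open>The choice of parameters\<close>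

locale mb_wish_parameters =
  fixes q r :: nat and \<gamma> \<kappa> :: real
  assumes q: "q \<ge> 3" and r_def: "r = (q - 1) div 2"
    and \<gamma>_def: "\<gamma> = real q / (3 * real r) * (1/2 - real r / real q)^2"
    and \<kappa>_def: "\<kappa> = real q / real r"
begin

lemma r_pos: "0 < r" using q by (auto simp: r_def)

lemma q_bounds: "2 * r + 1 \<le> q" "q \<le> 2 * r + 2" using q by (auto simp: r_def)

lemma \<kappa>_gt: "2 < \<kappa>"
  using q_bounds r_pos by (simp add: \<kappa>_def field_simps)

lemma \<gamma>_eq: "\<gamma> = (\<kappa> - 2)\<^sup>2 / (12 * \<kappa>)"
proof -
  have "real r / real q = 1 / \<kappa>" by (simp add: \<kappa>_def)
  moreover have "real q / (3 * real r) = \<kappa> / 3" by (simp add: \<kappa>_def)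
  ultimately have "\<gamma> = \<kappa> / 3 * (1/2 - 1/\<kappa>)\<^sup>2" by (simp only: \<gamma>_def)
  also have "1/2 - 1/\<kappa> = (\<kappa> - 2) / (2 * \<kappa>)" using \<kappa>_gt by (simp add: field_simps)
  also have "\<kappa> / 3 * ((\<kappa> - 2) / (2 * \<kappa>))\<^sup>2 = (\<kappa> - 2)\<^sup>2 / (12 * \<kappa>)"
    using \<kappa>_gt by (simp add: power_divide power_mult_distrib power2_eq_square)
  finally show ?thesis .
qed

lemma \<gamma>_pos: "0 < \<gamma>" using \<kappa>_gt by (simp add: \<gamma>_eq)

definition levels :: "nat \<Rightarrow> nat" where "levels n = nat \<lceil>real n * log \<kappa> (real q)\<rceil>"

definition samples :: "nat \<Rightarrow> real \<Rightarrow> nat" where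
  "samples n \<delta> = nat \<lceil>1 / \<gamma> * ln (2 * real n / \<delta>)\<rceil>"

lemma log_ge_1: "1 \<le> log \<kappa> (real q)"
proof -
  have "real q / real r \<le> real q / 1" using r_pos by (intro divide_left_mono) auto
  then have "\<kappa> \<le> real q" by (simp add: \<kappa>_def)
  then show ?thesis using \<kappa>_gt by simp
qed

lemma levels_ge: "n \<le> levels n"
proof -
  have "real n * 1 \<le> real n * log \<kappa> (real q)" using log_ge_1 by (intro mult_left_mono) auto
  then show ?thesis unfolding levels_def by linarith
qed

lemma levels_le:
  assumes "n \<ge> 1"
  shows "real (levels n) \<le> real n * (log \<kappa> (real q) + 1)"
proof -
  have "0 \<le> real n * log \<kappa> (real q)" using log_ge_1 by simp
  then have "real (levels n) \<le> real n * log \<kappa> (real q) + 1" unfolding levels_def by linarith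
  then show ?thesis using assms by (simp add: algebra_simps)
qed

text \<open>The number of levels is chosen for this: the blocks reach the last rank, as
  \<open>estimate_lower\<close> demands.\<close>

lemma power_levels: "real (q ^ n) \<le> \<kappa> ^ levels n"
proof -
  have "real (q ^ n) = \<kappa> powr (real n * log \<kappa> (real q))"
    using \<kappa>_gt q by (simp add: powr_powr[symmetric] powr_realpow mult.commute[of "real n"])
  also have "\<dots> \<le> \<kappa> powr real (levels n)"
    using \<kappa>_gt by (intro powr_mono) (auto simp: levels_def of_nat_ceiling)
  finally show ?thesis using \<kappa>_gt by (simp add: powr_realpow)
qed

text \<open>The ratio between the exponent that Chernoff's bound gives for an error probability of
  \<open>1 / (1 + \<kappa>)\<close> per sample and \<open>\<gamma>\<close>.\<close>

definition gain :: real where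
  "gain = 6 * \<kappa> * (\<kappa> - 1)\<^sup>2 / ((\<kappa> + 1)\<^sup>2 * (\<kappa> - 2)\<^sup>2)"

lemma gain_eq: "gain * \<gamma> = ((\<kappa> - 1) / (\<kappa> + 1))\<^sup>2 / 2"
  using \<kappa>_gt by (simp add: gain_def \<gamma>_eq power_divide)

text \<open>The square of the left side is 1 - ((\<kappa> - 1) / (\<kappa> + 1))^2, to which 1 - x
  \<le> exp (- x) applies; \<open>gain\<close> is defined to turn the exponent into a multiple of
  \<gamma>.\<close>

lemma decay_le: "2 * sqrt \<kappa> / (1 + \<kappa>) \<le> exp (- (gain * \<gamma>))"
proof (rule power2_le_imp_le)
  have "(2 * sqrt \<kappa> / (1 + \<kappa>))\<^sup>2 = 4 * \<kappa> / (1 + \<kappa>)\<^sup>2"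
    using \<kappa>_gt by (simp add: power_divide power_mult_distrib)
  also have "\<dots> = 1 - ((\<kappa> - 1) / (\<kappa> + 1))\<^sup>2"
    using \<kappa>_gt by (simp add: power_divide divide_simps) (simp add: power2_eq_square algebra_simps)
  also have "\<dots> \<le> exp (- (((\<kappa> - 1) / (\<kappa> + 1))\<^sup>2))"
    using exp_ge_add_one_self[of "- (((\<kappa> - 1) / (\<kappa> + 1))\<^sup>2)"] by simp
  also have "\<dots> = (exp (- (gain * \<gamma>)))\<^sup>2"
    unfolding gain_eq by (simp add: exp_double[symmetric])
  finally show "(2 * sqrt \<kappa> / (1 + \<kappa>))\<^sup>2 \<le> (exp (- (gain * \<gamma>)))\<^sup>2" .
qed simp

text \<open>The excess of the levels over n has to be at most 2^(gain - 1). For r = 1 we have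
  \<kappa> = q, so there are exactly n levels. For r \<ge> 2 we have \<kappa> \<le> 3, and
  \<open>gain\<close> is at least quadratic in r because 1 / (\<kappa> - 2) \<ge> r / 2, while
  log_\<kappa> q \<le> r + 1.\<close>

lemma gain_levels:
  assumes "n \<ge> 1"
  shows "1 \<le> gain" "real (levels n) \<le> real n * exp ((gain - 1) * ln 2)"
proof -
  have "1 \<le> gain \<and> real (levels n) \<le> real n * exp ((gain - 1) * ln 2)"
  proof (cases "r = 1")
    case True
    then have kq: "\<kappa> = real q" and "q = 3 \<or> q = 4" using q_bounds by (auto simp: \<kappa>_def)
    then have "\<kappa> = 3 \<or> \<kappa> = 4" by auto
    then have g: "1 \<le> gain" unfolding gain_def by auto
    have "log \<kappa> (real q) = 1" using kq \<kappa>_gt by simp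
    then have "levels n = n" by (simp add: levels_def)
    moreover have "real n * 1 \<le> real n * exp ((gain - 1) * ln 2)"
      using g by (intro mult_left_mono) auto
    ultimately show ?thesis using g by simp
  next
    case False
    then have r2: "r \<ge> 2" using r_pos by simp
    have k3: "\<kappa> \<le> 3" using q_bounds r2 by (simp add: \<kappa>_def field_simps)
    define t where "t = 1 / (\<kappa> - 2)"
    have t: "real r / 2 \<le> t"
    proof -
      have "\<kappa> \<le> (2 * real r + 2) / real r" unfolding \<kappa>_def using q_bounds by (intro divide_right_mono) auto
      then have "\<kappa> - 2 \<le> 2 / real r" using r_pos by (simp add: add_divide_distrib)
      then have "1 / (2 / real r) \<le> 1 / (\<kappa> - 2)" using \<kappa>_gt r_pos by (intro divide_left_mono) auto
      then show ?thesis by (simp add: t_def)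
    qed
    have "gain = 6 * \<kappa> / (\<kappa> + 1)\<^sup>2 * (1 + t)\<^sup>2"
    proof -
      have "1 + t = (\<kappa> - 1) / (\<kappa> - 2)" using \<kappa>_gt by (simp add: t_def field_simps)
      then show ?thesis by (simp add: gain_def power_divide)
    qed
    \<comment> \<open>9/8 is the value of 6 \<kappa> / (\<kappa> + 1)^2 at \<kappa> = 3, its minimum
      for 2 < \<kappa> \<le> 3.\<close>
    also have "\<dots> \<ge> 9/8 * (1 + t)\<^sup>2"
    proof (intro mult_right_mono)
      have "(3 * \<kappa> - 1) * (\<kappa> - 3) \<le> 0" using \<kappa>_gt k3 by (intro mult_nonneg_nonpos) auto
      then have "9 * (\<kappa> + 1)\<^sup>2 \<le> 48 * \<kappa>" by (simp add: power2_eq_square algebra_simps)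
      then show "9/8 \<le> 6 * \<kappa> / (\<kappa> + 1)\<^sup>2" using \<kappa>_gt by (simp add: pos_le_divide_eq)
    qed simp
    finally have g1: "9/8 * (1 + t)\<^sup>2 \<le> gain" .
    have "real (r + 2) \<le> 9/8 * (1 + real r / 2)\<^sup>2"
    proof -
      have "2 * real r \<le> real r * real r" using r2 by (intro mult_right_mono) auto
      moreover have "9/8 * (1 + real r / 2)\<^sup>2 = 9/8 + 9/8 * real r + 9/32 * (real r * real r)"
        by (simp add: power2_eq_square algebra_simps)
      moreover have "2 \<le> real r" using r2 by simp
      ultimately show ?thesis unfolding of_nat_add of_nat_numeral by linarith
    qed
    also have "\<dots> \<le> 9/8 * (1 + t)\<^sup>2" using t by (intro mult_left_mono power_mono) auto
    also note g1
    finally have g: "real (r + 1) \<le> gain - 1" by simp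
    have r2': "real (r + 1) \<le> 2 ^ r" using of_nat_mono[of "r + 1" "2 ^ r"] less_exp[of r] by simp
    have "real q \<le> 2 powr real (r + 1)"
    proof -
      have "real q \<le> 2 * real (r + 1)" using q_bounds by simp
      also have "\<dots> \<le> 2 * 2 ^ r" using r2' by simp
      also have "\<dots> = 2 powr real (r + 1)" by (subst powr_realpow) auto
      finally show ?thesis .
    qed
    then have "ln (real q) \<le> real (r + 1) * ln 2"
      using q by (metis ln_powr ln_mono of_nat_0_less_iff less_le_trans zero_less_numeral)
    also have "\<dots> \<le> real (r + 1) * ln \<kappa>" using \<kappa>_gt by (intro mult_left_mono) auto
    finally have "log \<kappa> (real q) \<le> real (r + 1)" using \<kappa>_gt by (simp add: log_def pos_divide_le_eq)
    then have "log \<kappa> (real q) + 1 \<le> 2 * real (r + 1)" using r2 by simp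
    also have "\<dots> \<le> 2 * 2 ^ r" using r2' by simp
    also have "\<dots> = exp (real (r + 1) * ln 2)" by (simp only: exp_of_nat_mult) simp
    also have "\<dots> \<le> exp ((gain - 1) * ln 2)" using g by simp
    finally have "real n * (log \<kappa> (real q) + 1) \<le> real n * exp ((gain - 1) * ln 2)"
      by (intro mult_left_mono) auto
    then show ?thesis using g levels_le[OF assms] by simp
  qed
  then show "1 \<le> gain" "real (levels n) \<le> real n * exp ((gain - 1) * ln 2)" by auto
qed

lemma samples_ge: "1 / \<gamma> * ln (2 * real n / \<delta>) \<le> real (samples n \<delta>)"
  by (simp add: samples_def of_nat_ceiling del: times_divide_eq_left)

text \<open>With X = ln (2 n / \<delta>) the bound is 2 n exp (- X) = \<delta> times exp ((gain - 1)
  (ln 2 - X)). The last factor is at most 1 since \<delta> \<le> 1 \<le> n gives X \<ge> ln 2; this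
  is where 2^(gain - 1) comes from.\<close>

lemma failure_le:
  assumes n: "n \<ge> 1" and \<delta>: "0 < \<delta>" "\<delta> \<le> 1"
  shows "real (levels n) * (2 * (2 * sqrt \<kappa> / (1 + \<kappa>)) ^ samples n \<delta>) \<le> \<delta>"
proof -
  define X where "X = ln (2 * real n / \<delta>)"
  have "2 * \<delta> \<le> 2 * real n" using n \<delta> by simp
  then have "2 \<le> 2 * real n / \<delta>" using \<delta> by (simp add: field_simps)
  then have X: "ln 2 \<le> X" unfolding X_def by simp
  have l: "X \<le> \<gamma> * real (samples n \<delta>)"
    using samples_ge[of n \<delta>] \<gamma>_pos by (simp add: X_def field_simps)
  have g: "1 \<le> gain" by (rule gain_levels[OF n])
  have "(2 * sqrt \<kappa> / (1 + \<kappa>)) ^ samples n \<delta> \<le> exp (- (gain * \<gamma>)) ^ samples n \<delta>"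
    using decay_le \<kappa>_gt by (intro power_mono) auto
  also have "\<dots> = exp (- (gain * (\<gamma> * real (samples n \<delta>))))"
    by (simp add: exp_of_nat_mult[symmetric] mult_ac)
  also have "\<dots> \<le> exp (- (gain * X))" using l g by simp
  finally have "real (levels n) * (2 * (2 * sqrt \<kappa> / (1 + \<kappa>)) ^ samples n \<delta>) \<le>
      real n * exp ((gain - 1) * ln 2) * (2 * exp (- (gain * X)))"
    using gain_levels(2)[OF n] \<kappa>_gt by (intro mult_mono) auto
  also have "\<dots> = 2 * real n * exp ((gain - 1) * (ln 2 - X) - X)"
    by (simp add: exp_add[symmetric] algebra_simps)
  also have "\<dots> \<le> 2 * real n * exp (- X)"
    using mult_nonneg_nonpos[of "gain - 1" "ln 2 - X"] g X by (intro mult_left_mono) auto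
  also have "\<dots> = \<delta>" using n \<delta> by (simp add: X_def exp_minus)
  finally show ?thesis .
qed

lemma samples_pos:
  assumes "n \<ge> 1" "0 < \<delta>" "\<delta> \<le> 1"
  shows "1 \<le> samples n \<delta>"
proof -
  have "1 < 2 * real n / \<delta>" using assms by (simp add: field_simps)
  then have "0 < 1 / \<gamma> * ln (2 * real n / \<delta>)" using \<gamma>_pos by simp
  then show ?thesis using samples_ge[of n \<delta>] by linarith
qed

text \<open>The 1 counts the call for \<open>M0\<close>. Once n / \<delta> \<ge> e the logarithm is
  at least 1, so this call, the summand ln 2 and the rounding of the sample count are absorbed into
  constants.\<close>

lemma calls_bigtheta:
  "(\<lambda>(n, \<delta>). real (1 + levels n * samples n \<delta>)) \<in> \<Theta>[ratio_at_top](\<lambda>(n, \<delta>). real n * ln (real n / \<delta>))"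
proof -
  define L where "L = log \<kappa> (real q) + 1"
  have L: "L \<ge> 2" using log_ge_1 by (simp add: L_def)
  have main: "1 / \<gamma> * (real n * ln (real n / \<delta>)) \<le> real (1 + levels n * samples n \<delta>) \<and>
      real (1 + levels n * samples n \<delta>) \<le> (1 + L * (2 / \<gamma> + 1)) * (real n * ln (real n / \<delta>)) \<and> 0 \<le> real n * ln (real n / \<delta>)"
    if n: "1 \<le> n" and \<delta>: "0 < \<delta>" and big: "exp 1 \<le> real n / \<delta>" for n \<delta>
  proof -
    define Y where "Y = ln (real n / \<delta>)"
    have Y: "1 \<le> Y" unfolding Y_def using big n \<delta> by (simp add: ln_ge_iff)
    have ln2: "ln (2 * real n / \<delta>) = ln 2 + Y"
      using ln_mult[of 2 "real n / \<delta>"] n \<delta> by (simp add: Y_def)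
    have ln2': "0 \<le> ln (2::real)" "ln (2::real) \<le> 1" using ln_2_less_1 by auto
    have lo: "1 / \<gamma> * Y \<le> real (samples n \<delta>)"
    proof -
      have "1 / \<gamma> * Y \<le> 1 / \<gamma> * (ln 2 + Y)" using ln2' \<gamma>_pos by (intro mult_left_mono) auto
      then show ?thesis using samples_ge[of n \<delta>] unfolding ln2 by linarith
    qed
    have hi: "real (samples n \<delta>) \<le> (2 / \<gamma> + 1) * Y"
    proof -
      have "0 \<le> 1 / \<gamma> * (ln 2 + Y)" using ln2' Y \<gamma>_pos by simp
      then have "real (samples n \<delta>) \<le> 1 / \<gamma> * (ln 2 + Y) + 1" unfolding samples_def ln2 by linarith
      also have "\<dots> \<le> 1 / \<gamma> * (2 * Y) + Y" using ln2' Y \<gamma>_pos by (intro add_mono mult_left_mono) auto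
      finally show ?thesis by (simp add: algebra_simps)
    qed
    have "real n * (1 / \<gamma> * Y) \<le> real (levels n) * real (samples n \<delta>)"
      using levels_ge[of n] lo Y \<gamma>_pos by (intro mult_mono) auto
    then have 1: "1 / \<gamma> * (real n * Y) \<le> real (1 + levels n * samples n \<delta>)" by (simp add: mult_ac)
    have "real (levels n) * real (samples n \<delta>) \<le> (real n * L) * ((2 / \<gamma> + 1) * Y)"
      using levels_le[OF n] hi L by (intro mult_mono) (auto simp: L_def)
    moreover have "1 * 1 \<le> real n * Y" using n Y by (intro mult_mono) auto
    ultimately have "real (1 + levels n * samples n \<delta>) \<le> real n * Y + (real n * L) * ((2 / \<gamma> + 1) * Y)" by simp
    also have "\<dots> = (1 + L * (2 / \<gamma> + 1)) * (real n * Y)" by (simp add: algebra_simps)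
    finally show ?thesis using 1 Y by (simp add: Y_def)
  qed
  show ?thesis
  proof (rule bigthetaI'[of "1 / \<gamma>" "1 + L * (2 / \<gamma> + 1)"])
    show "0 < 1 / \<gamma>" "0 < 1 + L * (2 / \<gamma> + 1)" using \<gamma>_pos L by (auto intro!: add_pos_nonneg)
    show "\<forall>\<^sub>F x in ratio_at_top.
      1 / \<gamma> * norm (case x of (n, \<delta>) \<Rightarrow> real n * ln (real n / \<delta>)) \<le> norm (case x of (n, \<delta>) \<Rightarrow> real (1 + levels n * samples n \<delta>)) \<and>
      norm (case x of (n, \<delta>) \<Rightarrow> real (1 + levels n * samples n \<delta>)) \<le>
        (1 + L * (2 / \<gamma> + 1)) * norm (case x of (n, \<delta>) \<Rightarrow> real n * ln (real n / \<delta>))"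
      unfolding eventually_ratio_at_top
    proof (intro exI[of _ "exp 1"] allI impI)
      fix n :: nat and \<delta> :: real assume h: "1 \<le> n" "0 < \<delta>" "exp 1 \<le> real n / \<delta>"
      then have "norm (real n * ln (real n / \<delta>)) = real n * ln (real n / \<delta>)"
        "norm (real (1 + levels n * samples n \<delta>)) = real (1 + levels n * samples n \<delta>)"
        using main[OF h] by (simp_all only: real_norm_def abs_of_nonneg of_nat_0_le_iff)
      then show "1 / \<gamma> * norm (case (n, \<delta>) of (n, \<delta>) \<Rightarrow> real n * ln (real n / \<delta>)) \<le> norm (case (n, \<delta>) of (n, \<delta>) \<Rightarrow> real (1 + levels n * samples n \<delta>)) \<and>
      norm (case (n, \<delta>) of (n, \<delta>) \<Rightarrow> real (1 + levels n * samples n \<delta>)) \<le>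
        (1 + L * (2 / \<gamma> + 1)) * norm (case (n, \<delta>) of (n, \<delta>) \<Rightarrow> real n * ln (real n / \<delta>))"
        using main[OF h] by (simp only: prod.case)
    qed
  qed
qed

end

section \<open>Assembling the algorithm\<close>

lemma unconstrained_mb_wish_eq:
  fixes \<alpha> :: "nat \<Rightarrow> 'a::{field,finite}"
  assumes "mb_wish_parameters q r \<gamma> \<kappa>" "q = CARD('a)"
  shows "unconstrained_mb_wish \<alpha> r \<gamma> \<delta> n w =
    map_pmf (\<lambda>(Ms, d). (max_over w (carrier_vec n) +
        (\<kappa> - 1) * (\<Sum>i<mb_wish_parameters.levels q \<kappa> n. Ms ! i * \<kappa> ^ i), 1 + d))
      (run_all (map (mb_wish_level \<alpha> r n w (mb_wish_parameters.samples \<gamma> n \<delta>))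
        [1..<Suc (mb_wish_parameters.levels q \<kappa> n)]))"
proof -
  interpret mb_wish_parameters q r \<gamma> \<kappa> by fact
  show ?thesis
    unfolding unconstrained_mb_wish_def max_oracle_def Let_def bind_return_pmf levels_def samples_def
      map_pmf_def assms(2)[symmetric] \<kappa>_def[symmetric] case_prod_unfold fst_conv snd_conv max_over_def ..
qed

text \<open>Every sample calls the oracle exactly once whatever the random choices, also on an empty
  set, so the count is deterministic.\<close>

lemma calls_unconstrained_mb_wish:
  fixes \<alpha> :: "nat \<Rightarrow> 'a::{field,finite}"
  assumes "mb_wish_parameters q r \<gamma> \<kappa>" "q = CARD('a)"
    and "(Z, calls) \<in> set_pmf (unconstrained_mb_wish \<alpha> r \<gamma> \<delta> n w)"
  shows "calls = 1 + mb_wish_parameters.levels q \<kappa> n * mb_wish_parameters.samples \<gamma> n \<delta>"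
proof -
  interpret mb_wish_parameters q r \<gamma> \<kappa> by fact
  obtain Ms d where d: "(Ms, d) \<in> set_pmf (run_all (map (mb_wish_level \<alpha> r n w (samples n \<delta>)) [1..<Suc (levels n)]))"
    and calls: "calls = 1 + d"
    using assms(3) unfolding unconstrained_mb_wish_eq[OF assms(1,2)] by (auto simp del: upt_Suc)
  have "c = samples n \<delta>" if mem: "(x, c) \<in> set_pmf (mb_wish_level \<alpha> r n w (samples n \<delta>) i)" for x c i
  proof -
    obtain ws where "(ws, c) \<in> set_pmf (run_all (replicate (samples n \<delta>) (mb_wish_sample \<alpha> r n w i)))"
      using mem unfolding mb_wish_level_map by auto
    then have "c = length (replicate (samples n \<delta>) (mb_wish_sample \<alpha> r n w i)) * 1"
      by (rule calls_run_all) (auto simp: mb_wish_sample_eq split: if_splits)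
    then show ?thesis by simp
  qed
  then have "d = length (map (mb_wish_level \<alpha> r n w (samples n \<delta>)) [1..<Suc (levels n)]) * samples n \<delta>"
    by (intro calls_run_all[OF d]) (auto simp del: upt_Suc)
  then show ?thesis using calls by simp
qed

lemma prob_unconstrained_mb_wish:
  fixes \<alpha> :: "nat \<Rightarrow> 'a::{field,finite}"
  assumes params: "mb_wish_parameters q r \<gamma> \<kappa>" and card: "q = CARD('a)"
    and bij: "bij_betw \<alpha> {..<q} UNIV" and n: "n \<ge> 1" and \<delta>: "0 < \<delta>"
    and nonneg: "\<And>\<sigma>. \<sigma> \<in> carrier_vec n \<Longrightarrow> 0 \<le> w \<sigma>"
  defines "S \<equiv> \<Sum>\<sigma>\<in>carrier_vec n. w \<sigma>"
  shows "1 - \<delta> \<le> measure_pmf.prob (unconstrained_mb_wish \<alpha> r \<gamma> \<delta> n w) {(Z, calls). S / \<kappa>\<^sup>2 \<le> Z \<and> Z \<le> \<kappa>\<^sup>2 * S}"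
proof (cases "\<delta> \<le> 1")
  case True
  interpret mb_wish_parameters q r \<gamma> \<kappa> by fact
  let ?V = "carrier_vec n :: 'a Matrix.vec set"
  obtain f where f: "bij_betw f {..<CARD('a) ^ n} ?V" "\<And>i j. i \<le> j \<Longrightarrow> j < CARD('a) ^ n \<Longrightarrow> w (f j) \<le> w (f i)"
    using decreasing_enumeration[of ?V w] by (auto simp: card_carrier_vec)
  let ?R = "run_all (map (mb_wish_level \<alpha> r n w (samples n \<delta>)) [1..<Suc (levels n)])"
  let ?Z = "\<lambda>Ms. max_over w ?V + (\<kappa> - 1) * (\<Sum>i<levels n. Ms ! i * \<kappa> ^ i)"
  let ?ok = "{(Ms, d). S / \<kappa>\<^sup>2 \<le> ?Z Ms \<and> ?Z Ms \<le> \<kappa>\<^sup>2 * S} :: (real list \<times> nat) set"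
  have "measure_pmf.prob ?R {(Ms, d). \<not> (S / \<kappa>\<^sup>2 \<le> ?Z Ms \<and> ?Z Ms \<le> \<kappa>\<^sup>2 * S)} \<le>
      real (levels n) * (2 * (2 * sqrt \<kappa> / (1 + \<kappa>)) ^ samples n \<delta>)"
    unfolding S_def
  proof (rule prob_estimate[where f = f and N = "CARD('a) ^ n"])
    show "1 \<le> n" "bij_betw f {..<CARD('a) ^ n} ?V" by fact+
    show "w (f j) \<le> w (f i)" if "i \<le> j" "j < CARD('a) ^ n" for i j using f(2) that .
    show "bij_betw \<alpha> {..<CARD('a)} UNIV" "\<kappa> = real CARD('a) / real r" using bij \<kappa>_def by (auto simp: card)
    show "real (CARD('a) ^ n) \<le> \<kappa> ^ levels n" using power_levels[of n] by (simp add: card)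
  qed (use nonneg r_pos \<kappa>_gt samples_pos[OF n \<delta> True] in auto)
  also have "\<dots> \<le> \<delta>" by (rule failure_le[OF n \<delta> True])
  also have "{(Ms, d). \<not> (S / \<kappa>\<^sup>2 \<le> ?Z Ms \<and> ?Z Ms \<le> \<kappa>\<^sup>2 * S)} = UNIV - ?ok" by auto
  finally have "1 - \<delta> \<le> measure_pmf.prob ?R ?ok"
    using measure_pmf.prob_compl[of ?ok ?R] by simp
  also have "?ok = (\<lambda>(Ms, d). (?Z Ms, 1 + d)) -` {(Z, calls). S / \<kappa>\<^sup>2 \<le> Z \<and> Z \<le> \<kappa>\<^sup>2 * S}" by auto
  finally show ?thesis
    unfolding unconstrained_mb_wish_eq[OF params card] measure_map_pmf .
next
  \<comment> \<open>For \<delta> > 1 the claimed lower bound is negative.\<close>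
  case False
  then show ?thesis using measure_nonneg[of "unconstrained_mb_wish \<alpha> r \<gamma> \<delta> n w"] by (smt (verit))
qed

theorem theorem3:
  fixes \<alpha> :: "nat \<Rightarrow> 'a::{field,finite}" and q r :: nat and \<gamma> :: real
  assumes "q = CARD('a)" and "q \<ge> 3"
    and "bij_betw \<alpha> {..<q} UNIV"
    and "r = (q - 1) div 2"
    and "\<gamma> = real q / (3 * real r) * (1/2 - real r / real q)^2"
  shows
    "(\<exists>T :: nat \<Rightarrow> real \<Rightarrow> nat.
        (\<forall>n\<ge>1. \<forall>\<delta>>0. \<forall>w. (\<forall>\<sigma>\<in>carrier_vec n. 0 \<le> w \<sigma>) \<longrightarrow>
           (\<forall>(Z, calls) \<in> set_pmf (unconstrained_mb_wish \<alpha> r \<gamma> \<delta> n w). calls = T n \<delta>)) \<and>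
        (\<lambda>(n, \<delta>). real (T n \<delta>))
          \<in> \<Theta>[ratio_at_top](\<lambda>(n, \<delta>). real n * ln (real n / \<delta>))) \<and>
     (\<forall>n\<ge>1. \<forall>\<delta>>0. \<forall>w. (\<forall>\<sigma>\<in>carrier_vec n. 0 \<le> w \<sigma>) \<longrightarrow>
        (let S = (\<Sum>\<sigma>\<in>carrier_vec n. w \<sigma>); \<kappa> = real q / real r in
         measure_pmf.prob (unconstrained_mb_wish \<alpha> r \<gamma> \<delta> n w)
           {(Z, calls). S / \<kappa>^2 \<le> Z \<and> Z \<le> \<kappa>^2 * S} \<ge> 1 - \<delta>))"
proof -
  interpret mb_wish_parameters q r \<gamma> "real q / real r"
    using assms by unfold_locales auto
  note params = mb_wish_parameters_axioms
  show ?thesis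
  proof (intro conjI exI[of _ "\<lambda>n \<delta>. 1 + levels n * samples n \<delta>"] allI impI calls_bigtheta)
    fix n :: nat and \<delta> :: real and w :: "'a Matrix.vec \<Rightarrow> real"
    assume h: "1 \<le> n" "0 < \<delta>" "\<forall>\<sigma>\<in>carrier_vec n. 0 \<le> w \<sigma>"
    show "\<forall>(Z, calls) \<in> set_pmf (unconstrained_mb_wish \<alpha> r \<gamma> \<delta> n w). calls = 1 + levels n * samples n \<delta>"
      using calls_unconstrained_mb_wish[OF params assms(1)] by blast
    show "let S = (\<Sum>\<sigma>\<in>carrier_vec n. w \<sigma>); \<kappa> = real q / real r in
         measure_pmf.prob (unconstrained_mb_wish \<alpha> r \<gamma> \<delta> n w)
           {(Z, calls). S / \<kappa>^2 \<le> Z \<and> Z \<le> \<kappa>^2 * S} \<ge> 1 - \<delta>"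
      unfolding Let_def using h by (intro prob_unconstrained_mb_wish[OF params assms(1,3)]) auto
  qed
qed

end
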